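(* Fix $\Gamma,\alpha,\nu>0$, $\rho_0=1$ and $u_0,e_0,u_1,e_1>0$. Let $c\in\mathcal{C}_{u_0,e_0}$ be any root of $\Psi(c)=(u_1,e_1)$, let $(\hat u,\hat e)$ be the corresponding profile and $\hat\rho=u_0/\hat u$, and let $D$ be the Evans function associated with the steady state $(\hat\rho,\hat u,\hat e)$. Then $$D(0)=\frac{\alpha\nu}{u_0^2}\,\det d\Psi(c);$$ in particular, $\operatorname{sgn}D(0)=\operatorname{sgn}\det d\Psi(c)$.
   Context: Profiles: for $c=(c_1,c_2)\in\mathbb{R}^2$ consider $$\frac{\alpha}{u_0}u'=c_1+u+\Gamma\frac{e}{u},\qquad \frac{\nu}{u_0}e'=c_2-c_1u-\frac12u^2+e,\qquad u(0)=u_0,\ e(0)=e_0,$$ on the domain $\{u>0\}$. The feasible set $\mathcal{C}_{u_0,e_0}$ is the (open) set of $c$ for which there is a continuous solution $(u,e)$ on $[0,1]$ with $u,e>0$ on $[0,1]$, and $\Psi(c)=(u,e)(1)$ for this solution. The profile corresponding to $c$ is this solution, denoted $(\hat u,\hat e)$; with $\hat\rho=u_0/\hat u$ it is a steady solution of the 1D compressible Navier--Stokes equations of a polytropic gas with $(\rho,u,e)(0)=(1,u_0,e_0)$ and $(u,e)(1)=(u_1,e_1)$. Eigenvalue problem at $(\hat\rho,\hat u,\hat e)$, for $\lambda\in\mathbb{C}$: $$\lambda\rho+(\hat\rho u+\hat u\rho)_x=0,$$ $$\lambda\hat\rho u+(\hat\rho\hat u u+\Gamma\hat\rho e+\Gamma\hat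 e\rho)_x+\hat u_x(\hat\rho u+\hat u\rho)=\alpha u_{xx},$$ $$\lambda\hat\rho e+(\hat\rho\hat u e)_x+\hat e_x(\hat\rho u+\hat u\rho)+\Gamma\hat\rho\hat e u_x+\Gamma\hat u_x(\hat\rho e+\hat e\rho)=\nu e_{xx}+2\alpha\hat u_xu_x.$$ The Evans function is $$D(\lambda)=\det\begin{pmatrix}u_1(1)&u_2(1)\\ e_1(1)&e_2(1)\end{pmatrix},$$ where (in this definition only, the subscripts $1,2$ label solutions and are unrelated to the boundary data $u_1,e_1$) $(\rho_j,u_j,e_j)$, $j=1,2$, are the solutions on $[0,1]$ of the eigenvalue system with initial conditions $(\rho_1,u_1,e_1,u_1',e_1')(0)=(0,0,0,1,0)$ and $(\rho_2,u_2,e_2,u_2',e_2')(0)=(0,0,0,0,1)$. *)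

theory Defs
  imports "HOL-Analysis.Analysis"
begin

text \<open>Derivative on the compact interval $[0,1]$, one-sided at the end points. Below it is only
  applied to functions that are required to be (or evidently are) differentiable on $[0,1]$.\<close>

definition dx :: "(real \<Rightarrow> 'a::real_normed_vector) \<Rightarrow> real \<Rightarrow> 'a" where
  "dx f x = vector_derivative f (at x within {0..1})"

definition is_profile ::
  "real \<Rightarrow> real \<Rightarrow> real \<Rightarrow> real \<Rightarrow> real \<Rightarrow> real^2 \<Rightarrow> (real \<Rightarrow> real) \<Rightarrow> (real \<Rightarrow> real) \<Rightarrow> bool" where
  "is_profile \<Gamma> \<alpha> \<nu> u0 e0 c u e \<longleftrightarrow>
     u differentiable_on {0..1} \<and> e differentiable_on {0..1} \<and>
     u 0 = u0 \<and> e 0 = e0 \<and>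
     (\<forall>x\<in>{0..1}. u x > 0 \<and> e x > 0) \<and>
     (\<forall>x\<in>{0..1}.
        \<alpha> / u0 * dx u x = c $ 1 + u x + \<Gamma> * (e x / u x) \<and>
        \<nu> / u0 * dx e x = c $ 2 - c $ 1 * u x - 1 / 2 * (u x)\<^sup>2 + e x)"

definition feasible :: "real \<Rightarrow> real \<Rightarrow> real \<Rightarrow> real \<Rightarrow> real \<Rightarrow> (real^2) set" where
  "feasible \<Gamma> \<alpha> \<nu> u0 e0 = {c. \<exists>u e. is_profile \<Gamma> \<alpha> \<nu> u0 e0 c u e}"

text \<open>Meaningful on the feasible set only; outside it the value is unspecified. The profile is
  determined on $[0,1]$, so its value at $1$ is unique.\<close>

definition Psi :: "real \<Rightarrow> real \<Rightarrow> real \<Rightarrow> real \<Rightarrow> real \<Rightarrow> real^2 \<Rightarrow> real^2" where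
  "Psi \<Gamma> \<alpha> \<nu> u0 e0 c =
     (THE v. \<exists>u e. is_profile \<Gamma> \<alpha> \<nu> u0 e0 c u e \<and> v = vector [u 1, e 1])"

text \<open>Classical solutions of the eigenvalue system at the steady state \<open>(rh, uh, eh)\<close>: \<open>\<rho>\<close> is once
  and \<open>u\<close>, \<open>e\<close> are twice differentiable on $[0,1]$. Real quantities are coerced to complex ones.\<close>

definition eigen_solution ::
  "real \<Rightarrow> real \<Rightarrow> real \<Rightarrow> (real \<Rightarrow> real) \<Rightarrow> (real \<Rightarrow> real) \<Rightarrow> (real \<Rightarrow> real) \<Rightarrow> complex \<Rightarrow>
   (real \<Rightarrow> complex) \<Rightarrow> (real \<Rightarrow> complex) \<Rightarrow> (real \<Rightarrow> complex) \<Rightarrow> bool" where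
  "eigen_solution \<Gamma> \<alpha> \<nu> rh uh eh l \<rho> u e \<longleftrightarrow>
     \<rho> differentiable_on {0..1} \<and>
     u differentiable_on {0..1} \<and> dx u differentiable_on {0..1} \<and>
     e differentiable_on {0..1} \<and> dx e differentiable_on {0..1} \<and>
     (\<forall>x\<in>{0..1}.
        l * \<rho> x + dx (\<lambda>y. rh y * u y + uh y * \<rho> y) x = 0 \<and>
        l * rh x * u x
          + dx (\<lambda>y. rh y * uh y * u y + \<Gamma> * rh y * e y + \<Gamma> * eh y * \<rho> y) x
          + dx uh x * (rh x * u x + uh x * \<rho> x)
          = \<alpha> * dx (dx u) x \<and>
        l * rh x * e x
          + dx (\<lambda>y. rh y * uh y * e y) x
          + dx eh x * (rh x * u x + uh x * \<rho> x)
          + \<Gamma> * rh x * eh x * dx u x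
          + \<Gamma> * dx uh x * (rh x * e x + eh x * \<rho> x)
          = \<nu> * dx (dx e) x + 2 * \<alpha> * dx uh x * dx u x)"

definition Evans ::
  "real \<Rightarrow> real \<Rightarrow> real \<Rightarrow> (real \<Rightarrow> real) \<Rightarrow> (real \<Rightarrow> real) \<Rightarrow> (real \<Rightarrow> real) \<Rightarrow> complex \<Rightarrow> complex" where
  "Evans \<Gamma> \<alpha> \<nu> rh uh eh l =
     (THE d. \<exists>\<rho>1 u1 e1 \<rho>2 u2 e2.
        eigen_solution \<Gamma> \<alpha> \<nu> rh uh eh l \<rho>1 u1 e1 \<and>
        \<rho>1 0 = 0 \<and> u1 0 = 0 \<and> e1 0 = 0 \<and> dx u1 0 = 1 \<and> dx e1 0 = 0 \<and>
        eigen_solution \<Gamma> \<alpha> \<nu> rh uh eh l \<rho>2 u2 e2 \<and>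
        \<rho>2 0 = 0 \<and> u2 0 = 0 \<and> e2 0 = 0 \<and> dx u2 0 = 0 \<and> dx e2 0 = 1 \<and>
        d = det (vector [vector [u1 1, u2 1], vector [e1 1, e2 1]] :: complex^2^2))"

end

theory Submission
  imports Defs
begin

text \<open>At \<open>\<lambda> = 0\<close> the eigenvalue system is a total derivative. Integrating it once turns it into the
  equation for the derivative of the profile in \<open>c\<close>, the constants of integration being the
  increment \<open>dc = (\<alpha> / u0 * u'(0), \<nu> / u0 * e'(0) + \<alpha> * u'(0))\<close>. The linear map
  \<open>(u'(0), e'(0)) \<mapsto> dc\<close> has determinant \<open>\<alpha> \<nu> / u0\<^sup>2\<close>, which is the factor in the theorem. That
  \<open>Psi\<close> is differentiable with the derivative given by the variational equation follows from
  Gronwall's inequality applied to the second-order remainder.\<close>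

text \<open>The vector field is singular at \<open>u = 0\<close> and has a quadratic term, so a
  positive solution on all of [0,1] for a nearby parameter is not given in advance, and
  \<open>Psi\<close> is unspecified off the feasible set. Differentiability at \<open>c\<close> thus
  contains the claim that \<open>c + h\<close> is feasible for small \<open>h\<close>. Both come
  from one construction: the perturbed profile is sought as the given profile plus a deviation, and
  the equation for the deviation is solved in a fixed ball on which its field is Lipschitz.
  \<open>Psi\<close> and \<open>Evans\<close> are definite descriptions, so existence and uniqueness
  are both required. For \<open>Evans\<close> this needs both directions between the eigenvalue
  system and the forced variational equation. The energy equation can be integrated only after the
  momentum equation, whose constant then enters the energy flux; this is why the second component of
  \<open>dc\<close> also contains \<open>u'(0)\<close> and the map to \<open>dc\<close> is
  triangular.\<close>

subsection \<open>Ordinary differential equations on the unit interval\<close>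

text \<open>Freezing a function at its end values outside [0,1] embeds continuous functions on [0,1]
  into the type of bounded continuous functions on the line, a complete space on which Banach's
  fixed point theorem can be used.\<close>

lemma clamped_continuous_bcontfun:
  fixes f :: "real \<Rightarrow> 'a::real_normed_vector"
  assumes "continuous_on {0..1} f"
  shows "(\<lambda>x. f (max 0 (min 1 x))) \<in> bcontfun"
proof -
  have "continuous_on UNIV (\<lambda>x. f (max 0 (min 1 x)))"
    by (rule continuous_on_compose2[OF assms]) (auto intro!: continuous_intros)
  moreover have "bounded (f ` {0..1})"
    by (intro compact_imp_bounded compact_continuous_image assms compact_Icc)
  then have "bounded (range (\<lambda>x. f (max 0 (min 1 x))))"
    by (rule bounded_subset) auto
  ultimately show ?thesis
    by (simp add: bcontfun_def)
qed

text \<open>The weight \<open>exp (K * t)\<close> with \<open>K > L\<close> makes the Picard operator a contraction on the whole of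
  $[0,1]$, so that no subdivision into short time steps is needed.\<close>

lemma lipschitz_ode_solution_exists:
  fixes G :: "real \<Rightarrow> 'a::banach \<Rightarrow> 'a"
  assumes cont: "continuous_on ({0..1} \<times> UNIV) (\<lambda>(t, x). G t x)"
    and lip: "\<And>t x y. t \<in> {0..1} \<Longrightarrow> norm (G t x - G t y) \<le> L * norm (x - y)"
    and "0 \<le> L"
  obtains X where "X 0 = x0"
    and "\<And>t. t \<in> {0..1} \<Longrightarrow> (X has_vector_derivative G t (X t)) (at t within {0..1})"
proof -
  define K where "K = L + 1"
  have K: "K > 0" using assms by (simp add: K_def)
  \<comment> \<open>The unknown is \<open>Z t = exp (- (K * t)) *\<^sub>R X t\<close>, so that the
    plain sup distance of \<open>Z\<close> is the weighted distance of \<open>X\<close>.\<close>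
  define F where "F Z t = G t (exp (K * t) *\<^sub>R Z t)" for Z :: "real \<Rightarrow> 'a" and t
  define P where "P Z s = exp (- (K * s)) *\<^sub>R (x0 + integral {0..s} (F Z))" for Z s
  have Fcont: "continuous_on {0..1} (F Z)" if "continuous_on {0..1} Z" for Z
  proof -
    have "continuous_on {0..1} (\<lambda>t. (case (t, exp (K * t) *\<^sub>R Z t) of (t, x) \<Rightarrow> G t x))"
      by (rule continuous_on_compose2[OF cont]) (auto intro!: continuous_intros that)
    then show ?thesis by (simp add: F_def[abs_def])
  qed
  have Pcont: "continuous_on {0..1} (P Z)" if "continuous_on {0..1} Z" for Z
    unfolding P_def
    by (intro continuous_intros indefinite_integral_continuous_1 integrable_continuous_real Fcont that)
  define T where "T Z = Bcontfun (\<lambda>x. P (apply_bcontfun Z) (max 0 (min 1 x)))"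
    for Z :: "real \<Rightarrow>\<^sub>C 'a"
  have Tapp: "apply_bcontfun (T Z) x = P (apply_bcontfun Z) (max 0 (min 1 x))" for Z x
    unfolding T_def
    by (subst Bcontfun_inverse) (auto intro!: clamped_continuous_bcontfun Pcont)
  have contr: "dist (T Z) (T W) \<le> (L / K) * dist Z W" for Z W
  proof (rule dist_bound)
    fix x :: real
    define s where "s = max 0 (min 1 x)"
    have s: "s \<in> {0..1}" by (auto simp: s_def)
    let ?z = "apply_bcontfun Z" and ?w = "apply_bcontfun W"
    have intF: "F (apply_bcontfun Y) integrable_on {0..s}" for Y
      using s by (intro integrable_continuous_real continuous_on_subset[OF Fcont]) auto
    \<comment> \<open>Integrating the weight gains a factor \<open>1 / K\<close> and leaves
      \<open>exp (K * s)\<close>, which the prefactor in \<open>P\<close> cancels; the contraction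
      constant becomes \<open>L / K\<close>.\<close>
    have expint: "((\<lambda>t. L * dist Z W * exp (K * t)) has_integral
        L * dist Z W * exp (K * s) / K - L * dist Z W * exp (K * 0) / K) {0..s}"
      using s K by (intro fundamental_theorem_of_calculus)
        (auto intro!: derivative_eq_intros simp: has_real_derivative_iff_has_vector_derivative[symmetric])
    have "norm (F ?z t - F ?w t) \<le> L * dist Z W * exp (K * t)" if "t \<in> {0..s}" for t
    proof -
      have "norm (F ?z t - F ?w t) \<le> L * norm (exp (K * t) *\<^sub>R ?z t - exp (K * t) *\<^sub>R ?w t)"
        unfolding F_def using s that by (intro lip) auto
      also have "\<dots> = L * exp (K * t) * dist (?z t) (?w t)"
        by (simp add: dist_norm flip: scaleR_diff_right)
      also have "\<dots> \<le> L * exp (K * t) * dist Z W"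
        using dist_bounded[of Z t W] assms(3) by (intro mult_left_mono) auto
      finally show ?thesis by (simp add: mult_ac)
    qed
    then have "norm (integral {0..s} (\<lambda>t. F ?z t - F ?w t))
        \<le> integral {0..s} (\<lambda>t. L * dist Z W * exp (K * t))"
      using expint by (intro integral_norm_bound_integral integrable_diff intF) auto
    also have "\<dots> = L * dist Z W * exp (K * s) / K - L * dist Z W / K"
      using integral_unique[OF expint] by simp
    also have "\<dots> \<le> L * dist Z W * exp (K * s) / K"
      using K assms(3) by simp
    finally have bd: "norm (integral {0..s} (F ?z) - integral {0..s} (F ?w))
        \<le> L * dist Z W * exp (K * s) / K"
      using intF by (simp add: integral_diff)
    have "dist (P ?z s) (P ?w s)
        = exp (- (K * s)) * norm (integral {0..s} (F ?z) - integral {0..s} (F ?w))"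
      by (simp add: P_def dist_norm flip: scaleR_diff_right)
    also have "\<dots> \<le> exp (- (K * s)) * (L * dist Z W * exp (K * s) / K)"
      by (intro mult_left_mono bd) auto
    also have "\<dots> = (L / K) * dist Z W"
      by (simp add: exp_minus field_simps)
    finally show "dist (apply_bcontfun (T Z) x) (apply_bcontfun (T W) x) \<le> (L / K) * dist Z W"
      by (simp add: Tapp s_def)
  qed
  have "L / K < 1" "0 \<le> L / K" using K assms(3) by (auto simp: K_def)
  then obtain Z where Z: "T Z = Z"
    using banach_fix_type[of "L / K" T] contr by blast
  let ?z = "apply_bcontfun Z"
  define X where "X t = exp (K * t) *\<^sub>R ?z t" for t
  have X: "X t = x0 + integral {0..t} (\<lambda>s. G s (X s))" if "t \<in> {0..1}" for t
  proof -
    have "?z t = P ?z t"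
      using Tapp[of Z t] that by (simp add: Z)
    then have "X t = exp (K * t) *\<^sub>R P ?z t" by (simp add: X_def)
    also have "\<dots> = x0 + integral {0..t} (F ?z)"
      by (simp add: P_def flip: exp_add)
    finally show ?thesis by (simp add: F_def[abs_def] X_def)
  qed
  have "continuous_on {0..1} (\<lambda>s. G s (X s))"
    using Fcont[of ?z] by (simp add: F_def[abs_def] X_def)
  then have der: "((\<lambda>t. x0 + integral {0..t} (\<lambda>s. G s (X s))) has_vector_derivative G t (X t))
      (at t within {0..1})" if "t \<in> {0..1}" for t
    using integral_has_vector_derivative[of 0 1 _ t] that by (auto intro!: derivative_eq_intros)
  show ?thesis
  proof
    show "X 0 = x0" using X[of 0] by simp
    show "(X has_vector_derivative G t (X t)) (at t within {0..1})" if "t \<in> {0..1}" for t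
      using that X by (intro has_vector_derivative_transform[OF that _ der[OF that]]) auto
  qed
qed

text \<open>Gronwall's inequality, obtained from the monotonicity of
  \<open>exp (- (2 L + 1) t) |Z t|\<^sup>2 - \<delta>\<^sup>2 t\<close>.\<close>

lemma gronwall_bound:
  fixes Z :: "real \<Rightarrow> 'a::real_inner"
  assumes der: "\<And>t. t \<in> {0..1} \<Longrightarrow> (Z has_vector_derivative Z' t) (at t within {0..1})"
    and bd: "\<And>t. t \<in> {0..1} \<Longrightarrow> norm (Z' t) \<le> L * norm (Z t) + \<delta>"
    and "Z 0 = 0" "0 \<le> L" "0 \<le> \<delta>" and t: "t \<in> {0..1}"
  shows "norm (Z t) \<le> exp ((2 * L + 1) / 2) * \<delta>"
proof -
  \<comment> \<open>Differentiating the squared norm gives \<open>2 * L\<close> from the linear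
    term, and \<open>2 * norm (Z s) * \<delta>\<close> is split into the two squares, which adds 1.
    The square root at the end turns \<open>exp k\<close> into \<open>exp (k / 2)\<close>. Working
    with the square avoids the points where the norm is not differentiable.\<close>
  define k where "k = 2 * L + 1"
  define f where "f s = exp (- (k * s)) * (Z s \<bullet> Z s) - \<delta>\<^sup>2 * s" for s
  have contZ: "continuous_on {0..1} Z"
    using der by (meson continuous_on_eq_continuous_within has_vector_derivative_continuous)
  have "f t \<le> f 0"
  proof (rule DERIV_nonpos_imp_decreasing_open[of 0 t f])
    show "0 \<le> t" using t by simp
    show "continuous_on {0..t} f"
      unfolding f_def using t
      by (intro continuous_intros continuous_on_subset[OF contZ]) auto
    fix s assume s: "0 < s" "s < t"
    then have s01: "s \<in> {0..1}" "s \<in> {0<..<1}" using t by auto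
    have "(Z has_vector_derivative Z' s) (at s)"
      using der[OF s01(1)] s01(2) by (simp add: at_within_Icc_at)
    then have "((\<lambda>s. Z s \<bullet> Z s) has_real_derivative Z s \<bullet> Z' s + Z' s \<bullet> Z s) (at s)"
      unfolding has_real_derivative_iff_has_vector_derivative
      by (intro bounded_bilinear.has_vector_derivative[OF bounded_bilinear_inner])
    moreover have "((\<lambda>s. exp (- (k * s))) has_real_derivative - k * exp (- (k * s))) (at s)"
      by (auto intro!: derivative_eq_intros)
    ultimately have "(f has_real_derivative - k * exp (- (k * s)) * (Z s \<bullet> Z s)
        + (Z s \<bullet> Z' s + Z' s \<bullet> Z s) * exp (- (k * s)) - \<delta>\<^sup>2 * 1) (at s)"
      unfolding f_def by (intro DERIV_diff DERIV_mult DERIV_cmult DERIV_ident)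
    moreover have "- k * exp (- (k * s)) * (Z s \<bullet> Z s)
        + (Z s \<bullet> Z' s + Z' s \<bullet> Z s) * exp (- (k * s)) - \<delta>\<^sup>2 * 1
        = exp (- (k * s)) * (- k * (Z s \<bullet> Z s) + 2 * (Z s \<bullet> Z' s)) - \<delta>\<^sup>2"
      by (simp add: inner_commute algebra_simps)
    ultimately have D: "(f has_real_derivative
        exp (- (k * s)) * (- k * (Z s \<bullet> Z s) + 2 * (Z s \<bullet> Z' s)) - \<delta>\<^sup>2) (at s)"
      by simp
    have "2 * (Z s \<bullet> Z' s) \<le> 2 * (norm (Z s) * norm (Z' s))"
      using norm_cauchy_schwarz[of "Z s" "Z' s"] by simp
    also have "\<dots> \<le> 2 * (norm (Z s) * (L * norm (Z s) + \<delta>))"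
      using bd[OF s01(1)] by (intro mult_left_mono) auto
    also have "\<dots> \<le> k * (Z s \<bullet> Z s) + \<delta>\<^sup>2"
      using sum_squares_bound[of "norm (Z s)" \<delta>]
      by (simp add: k_def dot_square_norm power2_eq_square algebra_simps)
    finally have "- k * (Z s \<bullet> Z s) + 2 * (Z s \<bullet> Z' s) \<le> \<delta>\<^sup>2" by simp
    then have "exp (- (k * s)) * (- k * (Z s \<bullet> Z s) + 2 * (Z s \<bullet> Z' s)) \<le> exp (- (k * s)) * \<delta>\<^sup>2"
      by (intro mult_left_mono) auto
    also have "\<dots> \<le> 1 * \<delta>\<^sup>2"
      using s assms(4) by (intro mult_right_mono) (auto simp: k_def)
    finally show "\<exists>y. (f has_real_derivative y) (at s) \<and> y \<le> 0"
      using D by fastforce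
  qed
  then have "exp (- (k * t)) * (norm (Z t))\<^sup>2 \<le> \<delta>\<^sup>2 * t"
    by (simp add: f_def assms(3) dot_square_norm)
  also have "\<dots> \<le> \<delta>\<^sup>2" using t by (simp add: mult_left_le)
  finally have "exp (k * t) * (exp (- (k * t)) * (norm (Z t))\<^sup>2) \<le> exp (k * t) * \<delta>\<^sup>2"
    by (intro mult_left_mono) auto
  then have "(norm (Z t))\<^sup>2 \<le> exp (k * t) * \<delta>\<^sup>2"
    by (simp flip: mult.assoc exp_add)
  also have "\<dots> \<le> exp k * \<delta>\<^sup>2"
    using t assms(4) by (intro mult_right_mono) (auto simp: k_def mult_left_le)
  also have "\<dots> = (exp (k / 2) * \<delta>)\<^sup>2"
    using exp_double[of "k / 2"] by (simp add: power_mult_distrib)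
  finally show ?thesis
    unfolding k_def by (rule power2_le_imp_le) (use assms(5) in auto)
qed

text \<open>Clamping the state with the nearest-point projection onto the ball of radius \<open>r\<close> makes
  the vector field globally Lipschitz; by Gronwall's inequality the clamp is inactive for small \<open>h\<close>.\<close>

lemma ode_solution_parameter_expansion:
  fixes g :: "'p::real_normed_vector \<Rightarrow> real \<Rightarrow> 'a::euclidean_space \<Rightarrow> 'a"
  assumes "0 < r" "0 \<le> L" "0 \<le> K"
    and cont: "\<And>h. norm h \<le> r \<Longrightarrow> continuous_on ({0..1} \<times> cball 0 r) (\<lambda>(t, z). g h t z)"
    and lip: "\<And>h t z w. norm h \<le> r \<Longrightarrow> t \<in> {0..1} \<Longrightarrow> norm z \<le> r \<Longrightarrow> norm w \<le> r \<Longrightarrow>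
          norm (g h t z - g h t w) \<le> L * norm (z - w)"
    and A: "\<And>t. t \<in> {0..1} \<Longrightarrow> linear (A t)"
    and Abd: "\<And>t z. t \<in> {0..1} \<Longrightarrow> norm (A t z) \<le> L * norm z"
    and Bbd: "\<And>t h. t \<in> {0..1} \<Longrightarrow> norm (B t h) \<le> L * norm h"
    and approx: "\<And>h t z. norm h \<le> r \<Longrightarrow> t \<in> {0..1} \<Longrightarrow> norm z \<le> r \<Longrightarrow>
          norm (g h t z - (A t z + B t h)) \<le> K * ((norm z)\<^sup>2 + (norm h)\<^sup>2)"
    and V0: "\<And>h. V h 0 = 0"
    and V: "\<And>h t. t \<in> {0..1} \<Longrightarrow>
          (V h has_vector_derivative A t (V h t) + B t h) (at t within {0..1})"
  obtains \<eta> C where "0 < \<eta>"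
    and "\<And>h. norm h \<le> \<eta> \<Longrightarrow> \<exists>z. z 0 = 0 \<and> (\<forall>t\<in>{0..1}. norm (z t) \<le> r \<and>
           (z has_vector_derivative g h t (z t)) (at t within {0..1})) \<and>
           norm (z 1 - V h 1) \<le> C * (norm h)\<^sup>2"
proof -
  define E where "E = exp ((2 * L + 1) / 2)"
  \<comment> \<open>Chosen so that solutions satisfy \<open>norm (z t) \<le> M * norm h\<close>. In
    the inhomogeneity, \<open>K * r\<close> comes from the quadratic error at \<open>z = 0\<close>,
    using \<open>norm h \<le> r\<close>, and \<open>L\<close> from the forcing
    \<open>B\<close>.\<close>
  define M where "M = E * (K * r + L)"
  have E: "0 < E" and M: "0 \<le> M" using assms(1-3) by (auto simp: E_def M_def)
  \<comment> \<open>The first bound makes the hypotheses on \<open>g h\<close> applicable, the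
    second gives \<open>M * norm h \<le> r\<close>; the denominator \<open>M + 1\<close> is positive
    even if \<open>M = 0\<close>.\<close>
  define \<eta> where "\<eta> = min r (r / (M + 1))"
  have \<eta>: "0 < \<eta>" using assms(1) M by (simp add: \<eta>_def)
  define p where "p = closest_point (cball (0::'a) r)"
  have cb: "convex (cball (0::'a) r)" "closed (cball (0::'a) r)" "cball (0::'a) r \<noteq> {}"
    using assms(1) by auto
  have p_in: "norm (p z) \<le> r" for z
    using closest_point_in_set[OF cb(2,3), of z] by (simp add: p_def)
  have p_lip: "norm (p z - p w) \<le> norm (z - w)" for z w
    using closest_point_lipschitz[OF cb, of z w] by (simp add: p_def dist_norm)
  have p_id: "p z = z" if "norm z \<le> r" for z
    using that by (simp add: p_def closest_point_self)
  have p_le: "norm (p z) \<le> norm z" for z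
    using p_lip[of z 0] p_id[of 0] assms(1) by simp
  have p_cont: "continuous_on S p" for S
    unfolding p_def by (rule continuous_on_closest_point[OF cb])
  have "\<exists>z. z 0 = 0 \<and> (\<forall>t\<in>{0..1}. norm (z t) \<le> r \<and>
           (z has_vector_derivative g h t (z t)) (at t within {0..1})) \<and>
           norm (z 1 - V h 1) \<le> (E * (K * (M\<^sup>2 + 1))) * (norm h)\<^sup>2"
    if h: "norm h \<le> \<eta>" for h
  proof -
    have hr: "norm h \<le> r" using h by (simp add: \<eta>_def)
    obtain z where z0: "z 0 = 0" and zd: "\<And>t. t \<in> {0..1} \<Longrightarrow>
        (z has_vector_derivative g h t (p (z t))) (at t within {0..1})"
    proof (rule lipschitz_ode_solution_exists[of "\<lambda>t x. g h t (p x)" L 0])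
      have "continuous_on ({0..1} \<times> UNIV) (\<lambda>q. case (fst q, p (snd q)) of (t, z) \<Rightarrow> g h t z)"
        by (rule continuous_on_compose2[OF cont[OF hr]])
          (auto intro!: continuous_intros continuous_on_compose2[OF p_cont] simp: p_in)
      then show "continuous_on ({0..1} \<times> UNIV) (\<lambda>(t, x). g h t (p x))"
        by (simp add: case_prod_beta')
      show "norm (g h t (p x) - g h t (p y)) \<le> L * norm (x - y)" if "t \<in> {0..1}" for t x y
        by (rule order_trans[OF lip[OF hr that p_in p_in] mult_left_mono[OF p_lip assms(2)]])
    qed (use assms(2) in auto)
    have zM: "norm (z t) \<le> M * norm h" if "t \<in> {0..1}" for t
    proof -
      have "norm (z t) \<le> exp ((2 * L + 1) / 2) * ((K * r + L) * norm h)"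
      proof (rule gronwall_bound[OF zd _ z0 assms(2) _ that])
        fix s :: real assume s: "s \<in> {0..1}"
        have "norm (g h s 0 - (A s 0 + B s h)) \<le> K * (norm h)\<^sup>2"
          using approx[OF hr s, of 0] assms(1) by simp
        also have "\<dots> \<le> K * (r * norm h)"
          unfolding power2_eq_square using hr assms(3) by (intro mult_left_mono mult_right_mono) auto
        finally have "norm (g h s 0 - B s h) \<le> K * r * norm h"
          using linear_0[OF A[OF s]] by simp
        moreover have "norm (g h s (p (z s)) - g h s 0) \<le> L * norm (z s)"
        proof -
          have "norm (g h s (p (z s)) - g h s 0) \<le> L * norm (p (z s) - 0)"
            using assms(1) by (intro lip hr s p_in) auto
          also have "\<dots> \<le> L * norm (z s)"
            using p_le assms(2) by (auto intro!: mult_left_mono)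
          finally show ?thesis .
        qed
        moreover have "norm (B s h) \<le> L * norm h" by (rule Bbd[OF s])
        moreover have "norm (g h s (p (z s))) \<le> norm (g h s (p (z s)) - g h s 0)
            + norm (g h s 0 - B s h) + norm (B s h)"
          by (smt (verit) norm_triangle_sub)
        ultimately show "norm (g h s (p (z s))) \<le> L * norm (z s) + (K * r + L) * norm h"
          by (simp add: algebra_simps)
      qed (use assms(1-3) in auto)
      then show ?thesis by (simp add: M_def E_def mult_ac)
    qed
    have "M * norm h \<le> M * (r / (M + 1))"
      using h M by (intro mult_left_mono) (auto simp: \<eta>_def)
    also have "\<dots> \<le> r" using M assms(1) by (simp add: field_simps)
    finally have zr: "norm (z t) \<le> r" if "t \<in> {0..1}" for t
      using zM[OF that] by simp
    have zd': "(z has_vector_derivative g h t (z t)) (at t within {0..1})" if "t \<in> {0..1}" for t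
      using zd[OF that] p_id[OF zr[OF that]] by simp
    \<comment> \<open>Since \<open>A t\<close> is linear, \<open>z - V h\<close> solves the
      linearized equation up to the Taylor error at \<open>z t\<close>, and the bound by
      \<open>M * norm h\<close> makes that error quadratic in \<open>h\<close>.\<close>
    have "norm (z 1 - V h 1) \<le> exp ((2 * L + 1) / 2) * (K * (M\<^sup>2 + 1) * (norm h)\<^sup>2)"
    proof (rule gronwall_bound[where Z = "\<lambda>t. z t - V h t"])
      fix t :: real assume t: "t \<in> {0..1}"
      show "((\<lambda>t. z t - V h t) has_vector_derivative g h t (z t) - (A t (V h t) + B t h))
          (at t within {0..1})"
        by (intro has_vector_derivative_diff zd' V t)
      have "g h t (z t) - (A t (V h t) + B t h)
          = A t (z t - V h t) + (g h t (z t) - (A t (z t) + B t h))"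
        by (simp add: linear_diff[OF A[OF t]])
      also have "norm \<dots> \<le> L * norm (z t - V h t) + K * ((norm (z t))\<^sup>2 + (norm h)\<^sup>2)"
        by (intro norm_triangle_mono Abd approx t hr zr)
      also have "K * ((norm (z t))\<^sup>2 + (norm h)\<^sup>2) \<le> K * ((M * norm h)\<^sup>2 + (norm h)\<^sup>2)"
        using zM[OF t] assms(3) by (intro mult_left_mono add_right_mono power_mono) auto
      finally show "norm (g h t (z t) - (A t (V h t) + B t h))
          \<le> L * norm (z t - V h t) + K * (M\<^sup>2 + 1) * (norm h)\<^sup>2"
        by (simp add: algebra_simps power_mult_distrib)
    qed (use z0 V0 assms(2,3) in auto)
    then have "norm (z 1 - V h 1) \<le> (E * (K * (M\<^sup>2 + 1))) * (norm h)\<^sup>2"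
      by (simp add: E_def mult_ac)
    with z0 zr zd' show ?thesis by blast
  qed
  with \<eta> show ?thesis by (rule that)
qed

subsection \<open>Profiles\<close>

lemma continuous_pos_bounds:
  fixes f :: "real \<Rightarrow> real"
  assumes "continuous_on {0..1} f" "\<And>t. t \<in> {0..1} \<Longrightarrow> 0 < f t"
  obtains a b where "0 < a" "\<And>t. t \<in> {0..1} \<Longrightarrow> a \<le> f t" "\<And>t. t \<in> {0..1} \<Longrightarrow> f t \<le> b"
proof -
  obtain s where s: "s \<in> {0..1}" "\<And>t. t \<in> {0..1} \<Longrightarrow> f s \<le> f t"
    using continuous_attains_inf[OF compact_Icc _ assms(1)] by auto
  obtain v where v: "v \<in> {0..1}" "\<And>t. t \<in> {0..1} \<Longrightarrow> f t \<le> f v"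
    using continuous_attains_sup[OF compact_Icc _ assms(1)] by auto
  show ?thesis using that[of "f s" "f v"] assms(2)[OF s(1)] s v by auto
qed

lemma has_derivative_quadratic_remainder:
  fixes f :: "'a::real_normed_vector \<Rightarrow> 'b::real_normed_vector"
  assumes "bounded_linear D" "0 < \<eta>"
    and bd: "\<And>h. norm h \<le> \<eta> \<Longrightarrow> norm (f (x + h) - f x - D h) \<le> C * (norm h)\<^sup>2"
  shows "(f has_derivative D) (at x)"
  unfolding has_derivative_at
proof
  show "(\<lambda>h. norm (f (x + h) - f x - D h) / norm h) \<midarrow>0\<rightarrow> 0"
  proof (rule tendsto_0_le)
    show "(\<lambda>h::'a. norm h) \<midarrow>0\<rightarrow> 0" by (rule tendsto_norm_zero) simp
    have "\<forall>\<^sub>F h in at 0. norm (h::'a) < \<eta>"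
      using assms(2) by (auto simp: eventually_at intro!: exI[of _ \<eta>])
    then show "\<forall>\<^sub>F h in at 0. norm (norm (f (x + h) - f x - D h) / norm h) \<le> norm (norm h) * C"
    proof eventually_elim
      case (elim h)
      then show ?case using bd[of h]
        by (cases "h = 0") (auto simp: field_simps power2_eq_square)
    qed
  qed
qed fact

section \<open>Derivatives on the closed unit interval\<close>

lemma within_unit_interval_nonbot:
  "t \<in> {0..1::real} \<Longrightarrow> at t within {0..1} \<noteq> bot"
  by (metis islimpt_Icc trivial_limit_within zero_less_one)

lemma dx_eqI:
  assumes "t \<in> {0..1}" "(f has_vector_derivative f') (at t within {0..1})"
  shows "dx f t = f'"
  unfolding dx_def
  by (rule vector_derivative_within[OF within_unit_interval_nonbot[OF assms(1)] assms(2)])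

lemma has_dx:
  assumes "f differentiable_on {0..1}" "t \<in> {0..1}"
  shows "(f has_vector_derivative dx f t) (at t within {0..1})"
  using assms unfolding dx_def differentiable_on_def by (simp flip: vector_derivative_works)

text \<open>\<open>vector_derivative\<close> is a choice among the possible derivatives, and
  \<open>f\<close> and \<open>g\<close> have the same ones at \<open>t\<close>; hence this holds
  without differentiability. It allows rewriting under \<open>dx\<close> with identities valid on
  [0,1] only, such as the one for \<open>rh\<close>.\<close>

lemma dx_cong:
  assumes "t \<in> {0..1}" "\<And>s. s \<in> {0..1} \<Longrightarrow> f s = g s"
  shows "dx f t = dx g t"
proof -
  have "(f has_vector_derivative d) (at t within {0..1})
      \<longleftrightarrow> (g has_vector_derivative d) (at t within {0..1})" for d
    using assms by (metis has_vector_derivative_transform)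
  then show ?thesis by (simp add: dx_def vector_derivative_def)
qed

lemma differentiable_onI_vector:
  assumes "\<And>t. t \<in> {0..1} \<Longrightarrow> (f has_vector_derivative f' t) (at t within {0..1})"
  shows "f differentiable_on {0..1}"
  using assms unfolding differentiable_on_def by (blast intro: differentiableI_vector)

section \<open>The profile equations as a planar first-order system\<close>

definition profile_field :: "real \<Rightarrow> real \<Rightarrow> real \<Rightarrow> real \<Rightarrow> real^2 \<Rightarrow> real \<times> real \<Rightarrow> real \<times> real"
  where "profile_field \<Gamma> \<alpha> \<nu> u0 c X =
    (u0 / \<alpha> * (c $ 1 + fst X + \<Gamma> * (snd X / fst X)),
     u0 / \<nu> * (c $ 2 - c $ 1 * fst X - 1 / 2 * (fst X)\<^sup>2 + snd X))"

text \<open>Passes from two scalar equations in \<open>dx\<close> to one vector equation for the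
  pair, the form to which Gronwall's inequality and the expansion in the parameter apply.\<close>

lemma is_profile_iff:
  assumes "\<alpha> > 0" "\<nu> > 0" "u0 > 0"
  shows "is_profile \<Gamma> \<alpha> \<nu> u0 e0 c u e \<longleftrightarrow>
    u 0 = u0 \<and> e 0 = e0 \<and> (\<forall>t\<in>{0..1}. u t > 0 \<and> e t > 0 \<and>
      ((\<lambda>t. (u t, e t)) has_vector_derivative profile_field \<Gamma> \<alpha> \<nu> u0 c (u t, e t))
        (at t within {0..1}))" (is "?L \<longleftrightarrow> ?R")
proof
  assume L: ?L
  show ?R
  proof (intro conjI ballI)
    fix t :: real assume t: "t \<in> {0..1}"
    have "(u has_vector_derivative dx u t) (at t within {0..1})"
      "(e has_vector_derivative dx e t) (at t within {0..1})"
      using L t by (auto simp: is_profile_def intro!: has_dx)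
    moreover have "(dx u t, dx e t) = profile_field \<Gamma> \<alpha> \<nu> u0 c (u t, e t)"
    proof -
      have "c $ 1 + u t + \<Gamma> * (e t / u t) = \<alpha> / u0 * dx u t"
        "c $ 2 - c $ 1 * u t - 1 / 2 * (u t)\<^sup>2 + e t = \<nu> / u0 * dx e t"
        using L t by (simp_all add: is_profile_def)
      then show ?thesis
        unfolding profile_field_def fst_conv snd_conv using assms by simp
    qed
    ultimately show "((\<lambda>t. (u t, e t)) has_vector_derivative
        profile_field \<Gamma> \<alpha> \<nu> u0 c (u t, e t)) (at t within {0..1})"
      by (metis has_vector_derivative_Pair)
  qed (use L in \<open>auto simp: is_profile_def\<close>)
next
  assume R: ?R
  have u: "(u has_vector_derivative fst (profile_field \<Gamma> \<alpha> \<nu> u0 c (u t, e t))) (at t within {0..1})"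
    if "t \<in> {0..1}" for t
    using bounded_linear.has_vector_derivative[OF bounded_linear_fst] R that by fastforce
  have e: "(e has_vector_derivative snd (profile_field \<Gamma> \<alpha> \<nu> u0 c (u t, e t))) (at t within {0..1})"
    if "t \<in> {0..1}" for t
    using bounded_linear.has_vector_derivative[OF bounded_linear_snd] R that by fastforce
  show ?L
    unfolding is_profile_def
    using R assms differentiable_onI_vector[OF u] differentiable_onI_vector[OF e]
      dx_eqI[OF _ u] dx_eqI[OF _ e]
    by (auto simp: profile_field_def)
qed

lemma profile_continuous:
  assumes "is_profile \<Gamma> \<alpha> \<nu> u0 e0 c u e"
  shows "continuous_on {0..1} u" "continuous_on {0..1} e"
  using assms by (auto simp: is_profile_def intro: differentiable_imp_continuous_on)

text \<open>Compactness keeps a profile at a positive distance \<open>a\<close> from the singularity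
  \<open>u = 0\<close>; all later Lipschitz and Taylor constants are expressed in \<open>a\<close>
  and \<open>b\<close>.\<close>

lemma profile_bounds:
  assumes "is_profile \<Gamma> \<alpha> \<nu> u0 e0 c u e"
  obtains a b where "0 < a" "\<And>t. t \<in> {0..1} \<Longrightarrow> a \<le> u t \<and> u t \<le> b \<and> a \<le> e t \<and> e t \<le> b"
proof -
  obtain a1 b1 where 1: "0 < a1" "\<And>t. t \<in> {0..1} \<Longrightarrow> a1 \<le> u t" "\<And>t. t \<in> {0..1} \<Longrightarrow> u t \<le> b1"
    using continuous_pos_bounds[of u] profile_continuous[OF assms] assms
    unfolding is_profile_def by metis
  obtain a2 b2 where 2: "0 < a2" "\<And>t. t \<in> {0..1} \<Longrightarrow> a2 \<le> e t" "\<And>t. t \<in> {0..1} \<Longrightarrow> e t \<le> b2"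
    using continuous_pos_bounds[of e] profile_continuous[OF assms] assms
    unfolding is_profile_def by metis
  show ?thesis
    using that[of "min a1 a2" "max b1 b2"] 1 2 by (auto simp: min_le_iff_disj le_max_iff_disj)
qed

lemma norm_Pair_le_scaled:
  assumes "norm x \<le> k * d" "norm y \<le> l * d"
  shows "norm (x, y) \<le> (k + l) * d"
  using norm_Pair_le[of x y] assms by (simp add: algebra_simps)

lemma divide_lipschitz:
  fixes u e w f a b :: real
  assumes "0 < a" "a \<le> u" "a \<le> w" "\<bar>f\<bar> \<le> b"
  shows "\<bar>e / u - f / w\<bar> \<le> \<bar>e - f\<bar> / a + b * \<bar>u - w\<bar> / a\<^sup>2"
proof -
  have "e / u - f / w = (e - f) / u + f * (w - u) / (u * w)"
    using assms by (simp add: field_simps)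
  also have "\<bar>\<dots>\<bar> \<le> \<bar>e - f\<bar> / u + \<bar>f\<bar> * \<bar>u - w\<bar> / (u * w)"
    using assms abs_triangle_ineq[of "(e - f) / u" "f * (w - u) / (u * w)"]
    by (simp add: abs_mult abs_minus_commute)
  also have "\<dots> \<le> \<bar>e - f\<bar> / a + b * \<bar>u - w\<bar> / a\<^sup>2"
    unfolding power2_eq_square
    using assms by (intro add_mono frac_le mult_mono) auto
  finally show ?thesis .
qed

text \<open>\<open>c $ 2\<close> cancels in the difference, so only \<open>c $ 1\<close> has to be
  bounded. The bound \<open>k\<close> is kept free so that the same estimate serves for
  \<open>c + h\<close>.\<close>

lemma profile_field_lipschitz:
  assumes pos: "\<Gamma> > 0" "\<alpha> > 0" "\<nu> > 0" "u0 > 0" and "0 < a"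
    and X: "a \<le> fst X" "fst X \<le> b" and Y: "a \<le> fst Y" "fst Y \<le> b" "\<bar>snd Y\<bar> \<le> b"
    and c: "\<bar>c $ 1\<bar> \<le> k"
  shows "norm (profile_field \<Gamma> \<alpha> \<nu> u0 c X - profile_field \<Gamma> \<alpha> \<nu> u0 c Y)
    \<le> (u0 / \<alpha> * (1 + \<Gamma> * (1 / a + b / a\<^sup>2)) + u0 / \<nu> * (k + b + 1)) * norm (X - Y)"
proof -
  obtain u e w f where XY: "X = (u, e)" "Y = (w, f)" by fastforce
  define d where "d = norm (X - Y)"
  have d: "\<bar>u - w\<bar> \<le> d" "\<bar>e - f\<bar> \<le> d" "0 \<le> d"
    using norm_fst_le[of "u - w" "e - f"] norm_snd_le[of "e - f" "u - w"] by (auto simp: d_def XY)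
  have b: "0 \<le> b" using assms by (auto simp: XY)
  have "\<bar>(u - w) + \<Gamma> * (e / u - f / w)\<bar> \<le> \<bar>u - w\<bar> + \<Gamma> * \<bar>e / u - f / w\<bar>"
    using pos abs_triangle_ineq[of "u - w" "\<Gamma> * (e / u - f / w)"] by (simp add: abs_mult)
  also have "\<dots> \<le> d + \<Gamma> * (\<bar>e - f\<bar> / a + b * \<bar>u - w\<bar> / a\<^sup>2)"
    using assms d by (intro add_mono mult_left_mono divide_lipschitz) (auto simp: XY)
  also have "\<dots> \<le> d + \<Gamma> * (d / a + b * d / a\<^sup>2)"
    using assms d b by (intro add_mono mult_left_mono divide_right_mono) auto
  finally have "\<bar>u0 / \<alpha> * ((u - w) + \<Gamma> * (e / u - f / w))\<bar> \<le> u0 / \<alpha> * (d + \<Gamma> * (d / a + b * d / a\<^sup>2))"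
    using pos unfolding abs_mult by (intro mult_mono) auto
  then have 1: "norm (fst (profile_field \<Gamma> \<alpha> \<nu> u0 c X) - fst (profile_field \<Gamma> \<alpha> \<nu> u0 c Y))
      \<le> u0 / \<alpha> * (1 + \<Gamma> * (1 / a + b / a\<^sup>2)) * d"
    by (simp add: profile_field_def XY algebra_simps add_divide_distrib)
  have sq: "u\<^sup>2 - w\<^sup>2 = (u + w) * (u - w)" by (simp add: power2_eq_square algebra_simps)
  have "\<bar>- (c $ 1 * (u - w)) - 1 / 2 * (u\<^sup>2 - w\<^sup>2) + (e - f)\<bar>
      \<le> \<bar>c $ 1\<bar> * \<bar>u - w\<bar> + \<bar>u + w\<bar> / 2 * \<bar>u - w\<bar> + \<bar>e - f\<bar>"
    unfolding sq by (simp flip: abs_mult)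
  also have "\<dots> \<le> k * d + b * d + d"
    using assms d by (intro add_mono mult_mono) (auto simp: XY)
  finally have "\<bar>u0 / \<nu> * (- (c $ 1 * (u - w)) - 1 / 2 * (u\<^sup>2 - w\<^sup>2) + (e - f))\<bar>
      \<le> u0 / \<nu> * (k * d + b * d + d)"
    using pos unfolding abs_mult by (intro mult_mono) auto
  then have 2: "norm (snd (profile_field \<Gamma> \<alpha> \<nu> u0 c X) - snd (profile_field \<Gamma> \<alpha> \<nu> u0 c Y))
      \<le> u0 / \<nu> * (k + b + 1) * d"
    by (simp add: profile_field_def XY algebra_simps add_divide_distrib)
  show ?thesis
    using norm_Pair_le_scaled[OF 1 2] by (simp add: d_def minus_prod_def)
qed

text \<open>Both profiles lie in one common region \<open>a\<close>, \<open>b\<close> where the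
  field is Lipschitz, so Gronwall's inequality with \<open>\<delta> = 0\<close> applies to their
  difference.\<close>

lemma profile_unique:
  assumes pos: "\<Gamma> > 0" "\<alpha> > 0" "\<nu> > 0" "u0 > 0"
    and p: "is_profile \<Gamma> \<alpha> \<nu> u0 e0 c u e" and q: "is_profile \<Gamma> \<alpha> \<nu> u0 e0 c w f"
    and t: "t \<in> {0..1}"
  shows "u t = w t \<and> e t = f t"
proof -
  obtain a1 b1 where 1: "0 < a1" "\<And>t. t \<in> {0..1} \<Longrightarrow> a1 \<le> u t \<and> u t \<le> b1 \<and> a1 \<le> e t \<and> e t \<le> b1"
    using profile_bounds[OF p] by blast
  obtain a2 b2 where 2: "0 < a2" "\<And>t. t \<in> {0..1} \<Longrightarrow> a2 \<le> w t \<and> w t \<le> b2 \<and> a2 \<le> f t \<and> f t \<le> b2"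
    using profile_bounds[OF q] by blast
  define a b where "a = min a1 a2" and "b = max b1 b2"
  define L where "L = u0 / \<alpha> * (1 + \<Gamma> * (1 / a + b / a\<^sup>2)) + u0 / \<nu> * (\<bar>c $ 1\<bar> + b + 1)"
  have a: "0 < a" and ab: "\<And>s. s \<in> {0..1} \<Longrightarrow> a \<le> u s \<and> u s \<le> b \<and> a \<le> w s \<and> w s \<le> b \<and> \<bar>f s\<bar> \<le> b"
    using 1 2 by (fastforce simp: a_def b_def min_le_iff_disj le_max_iff_disj)+
  have "0 \<le> b" using a ab[OF t] by linarith
  then have L: "0 \<le> L" using pos a by (simp add: L_def)
  have "norm ((u t, e t) - (w t, f t)) \<le> exp ((2 * L + 1) / 2) * 0"
  proof (rule gronwall_bound[OF _ _ _ L _ t])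
    fix s :: real assume s: "s \<in> {0..1}"
    show "((\<lambda>s. (u s, e s) - (w s, f s)) has_vector_derivative
        profile_field \<Gamma> \<alpha> \<nu> u0 c (u s, e s) - profile_field \<Gamma> \<alpha> \<nu> u0 c (w s, f s)) (at s within {0..1})"
      using p q s unfolding is_profile_iff[OF pos(2-4)]
      by (intro has_vector_derivative_diff) auto
    show "norm (profile_field \<Gamma> \<alpha> \<nu> u0 c (u s, e s) - profile_field \<Gamma> \<alpha> \<nu> u0 c (w s, f s))
        \<le> L * norm ((u s, e s) - (w s, f s)) + 0"
      unfolding L_def using ab[OF s] a
      by (intro order_trans[OF profile_field_lipschitz[OF pos a]]) auto
  next
    show "(u 0, e 0) - (w 0, f 0) = 0"
      using p q by (simp add: is_profile_def zero_prod_def)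
  qed auto
  then show ?thesis by (simp add: zero_prod_def)
qed

lemma Psi_eq:
  assumes "\<Gamma> > 0" "\<alpha> > 0" "\<nu> > 0" "u0 > 0" and p: "is_profile \<Gamma> \<alpha> \<nu> u0 e0 c u e"
  shows "Psi \<Gamma> \<alpha> \<nu> u0 e0 c = vector [u 1, e 1]"
  unfolding Psi_def
proof (rule the_equality)
  fix v :: "real^2"
  assume "\<exists>w f. is_profile \<Gamma> \<alpha> \<nu> u0 e0 c w f \<and> v = vector [w 1, f 1]"
  then obtain w f where q: "is_profile \<Gamma> \<alpha> \<nu> u0 e0 c w f" and v: "v = vector [w 1, f 1]"
    by blast
  show "v = vector [u 1, e 1]"
    using profile_unique[OF assms(1-4) p q, of 1] v by simp
qed (use p in blast)

subsection \<open>The derivative of the end-point map\<close>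

lemma linear_vector_2: "linear f \<Longrightarrow> linear g \<Longrightarrow> linear (\<lambda>h. vector [f h, g h] :: real^2)"
  by (rule linearI) (auto simp: vec_eq_iff forall_2 linear_add linear_scale)

locale steady_profile =
  fixes \<Gamma> \<alpha> \<nu> u0 e0 :: real and c :: "real^2" and uh eh :: "real \<Rightarrow> real"
  assumes pos: "\<Gamma> > 0" "\<alpha> > 0" "\<nu> > 0" "u0 > 0"
    and profile: "is_profile \<Gamma> \<alpha> \<nu> u0 e0 c uh eh"
begin

text \<open>The scalar type is a parameter: the derivative of \<open>Psi\<close> uses real and the Evans function
  complex scalars.\<close>

definition lin :: "real \<Rightarrow> 'a \<times> 'a \<Rightarrow> 'a::real_vector \<times> 'a" where
  "lin t Z = ((u0 / \<alpha>) *\<^sub>R (fst Z + \<Gamma> *\<^sub>R ((1 / uh t) *\<^sub>R snd Z - (eh t / (uh t)\<^sup>2) *\<^sub>R fst Z)),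
     (u0 / \<nu>) *\<^sub>R (snd Z - (c $ 1 + uh t) *\<^sub>R fst Z))"

text \<open>Derivative of \<open>profile_field\<close> with respect to the parameter in direction
  \<open>H\<close>, taken along the profile; \<open>lin\<close> is its derivative with respect to
  the state.\<close>

definition forcing :: "real \<Rightarrow> 'a \<times> 'a \<Rightarrow> 'a::real_vector \<times> 'a" where
  "forcing t H = ((u0 / \<alpha>) *\<^sub>R fst H, (u0 / \<nu>) *\<^sub>R (snd H - uh t *\<^sub>R fst H))"

lemma uh_pos: "t \<in> {0..1} \<Longrightarrow> 0 < uh t" and eh_pos: "t \<in> {0..1} \<Longrightarrow> 0 < eh t"
  and uh_0: "uh 0 = u0"
  using profile by (auto simp: is_profile_def)

lemma linear_lin: "linear (lin t :: 'a::real_vector \<times> 'a \<Rightarrow> 'a \<times> 'a)"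
  by (rule linearI) (simp_all add: lin_def algebra_simps)

lemma norm_lin_le:
  fixes Z :: "'a::real_normed_vector \<times> 'a"
  assumes "0 < a" "a \<le> uh t" "uh t \<le> b" "0 < eh t" "eh t \<le> b"
  shows "norm (lin t Z)
    \<le> (u0 / \<alpha> * (1 + \<Gamma> * (1 / a + b / a\<^sup>2)) + u0 / \<nu> * (1 + (\<bar>c $ 1\<bar> + b))) * norm Z"
proof -
  obtain y z where Z: "Z = (y, z)" by fastforce
  define d where "d = norm Z"
  have d: "norm y \<le> d" "norm z \<le> d" "0 \<le> d"
    using norm_fst_le[of y z] norm_snd_le[of z y] by (auto simp: d_def Z)
  have "norm ((1 / uh t) *\<^sub>R z - (eh t / (uh t)\<^sup>2) *\<^sub>R y)
      \<le> (1 / uh t) * norm z + (eh t / (uh t)\<^sup>2) * norm y"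
    using assms by (intro order_trans[OF norm_triangle_ineq4]) simp
  also have "\<dots> \<le> (1 / a) * d + (b / a\<^sup>2) * d"
    using assms d by (intro add_mono mult_mono frac_le power_mono) auto
  finally have "norm (y + \<Gamma> *\<^sub>R ((1 / uh t) *\<^sub>R z - (eh t / (uh t)\<^sup>2) *\<^sub>R y))
      \<le> d + \<Gamma> * ((1 / a) * d + (b / a\<^sup>2) * d)"
    using pos d by (intro order_trans[OF norm_triangle_ineq] add_mono) auto
  then have "u0 / \<alpha> * norm (y + \<Gamma> *\<^sub>R ((1 / uh t) *\<^sub>R z - (eh t / (uh t)\<^sup>2) *\<^sub>R y))
      \<le> u0 / \<alpha> * (d + \<Gamma> * ((1 / a) * d + (b / a\<^sup>2) * d))"
    using pos by (intro mult_left_mono) auto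
  also have "\<dots> = u0 / \<alpha> * (1 + \<Gamma> * (1 / a + b / a\<^sup>2)) * d"
    by (simp add: distrib_left distrib_right)
  finally have 1: "norm (fst (lin t Z)) \<le> u0 / \<alpha> * (1 + \<Gamma> * (1 / a + b / a\<^sup>2)) * d"
    using pos by (simp add: lin_def Z)
  have "norm (z - (c $ 1 + uh t) *\<^sub>R y) \<le> norm z + \<bar>c $ 1 + uh t\<bar> * norm y"
    by (intro order_trans[OF norm_triangle_ineq4]) simp
  also have "\<dots> \<le> d + (\<bar>c $ 1\<bar> + b) * d"
    using assms d by (intro add_mono mult_mono) auto
  finally have "u0 / \<nu> * norm (z - (c $ 1 + uh t) *\<^sub>R y) \<le> u0 / \<nu> * (d + (\<bar>c $ 1\<bar> + b) * d)"
    using pos by (intro mult_left_mono) auto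
  also have "\<dots> = u0 / \<nu> * (1 + (\<bar>c $ 1\<bar> + b)) * d"
    by (simp add: distrib_left distrib_right)
  finally have 2: "norm (snd (lin t Z)) \<le> u0 / \<nu> * (1 + (\<bar>c $ 1\<bar> + b)) * d"
    using pos by (simp add: lin_def Z)
  show ?thesis using norm_Pair_le_scaled[OF 1 2] by (simp add: d_def)
qed

lemma lin_bounded:
  obtains L where "0 \<le> L"
    and "\<And>t (Z :: 'a::real_normed_vector \<times> 'a). t \<in> {0..1} \<Longrightarrow> norm (lin t Z) \<le> L * norm Z"
proof -
  obtain a b where ab: "0 < a" "\<And>t. t \<in> {0..1} \<Longrightarrow> a \<le> uh t \<and> uh t \<le> b \<and> a \<le> eh t \<and> eh t \<le> b"
    using profile_bounds[OF profile] by blast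
  have b: "0 \<le> b" using ab(1) ab(2)[of 0] by simp
  show ?thesis
  proof
    show "0 \<le> u0 / \<alpha> * (1 + \<Gamma> * (1 / a + b / a\<^sup>2)) + u0 / \<nu> * (1 + (\<bar>c $ 1\<bar> + b))"
      using pos ab(1) b by simp
    show "norm (lin t Z)
        \<le> (u0 / \<alpha> * (1 + \<Gamma> * (1 / a + b / a\<^sup>2)) + u0 / \<nu> * (1 + (\<bar>c $ 1\<bar> + b))) * norm Z"
      if "t \<in> {0..1}" for t and Z :: "'a \<times> 'a"
      using ab that eh_pos by (intro norm_lin_le) auto
  qed
qed

lemma lin_ode_unique:
  fixes Z :: "real \<Rightarrow> 'a::real_inner \<times> 'a"
  assumes "Z 0 = 0" "\<And>t. t \<in> {0..1} \<Longrightarrow> (Z has_vector_derivative lin t (Z t)) (at t within {0..1})"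
    and "t \<in> {0..1}"
  shows "Z t = 0"
proof -
  obtain L where L: "0 \<le> L" "\<And>t (Z :: 'a \<times> 'a). t \<in> {0..1} \<Longrightarrow> norm (lin t Z) \<le> L * norm Z"
    using lin_bounded by blast
  have "norm (Z t) \<le> exp ((2 * L + 1) / 2) * 0"
    by (rule gronwall_bound[OF assms(2) _ assms(1) L(1)]) (use L(2) assms(3) in auto)
  then show ?thesis by simp
qed

section \<open>The first variation of the profile with respect to the parameter\<close>

lemma variation_exists:
  fixes H :: "real \<times> real"
  shows "\<exists>V. V 0 = 0 \<and> (\<forall>t\<in>{0..1}.
    (V has_vector_derivative lin t (V t) + forcing t H) (at t within {0..1}))"
proof -
  obtain L where L: "0 \<le> L" "\<And>t (Z :: real \<times> real). t \<in> {0..1} \<Longrightarrow> norm (lin t Z) \<le> L * norm Z"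
    using lin_bounded by blast
  show ?thesis
  proof (rule lipschitz_ode_solution_exists[of "\<lambda>t x. lin t x + forcing t H" L 0])
    have "continuous_on ({0..1} \<times> (UNIV :: (real \<times> real) set)) (\<lambda>q. uh (fst q))"
      "continuous_on ({0..1} \<times> (UNIV :: (real \<times> real) set)) (\<lambda>q. eh (fst q))"
      by (auto intro!: continuous_intros continuous_on_compose2[OF profile_continuous(1)[OF profile]]
            continuous_on_compose2[OF profile_continuous(2)[OF profile]])
    then show "continuous_on ({0..1} \<times> UNIV) (\<lambda>(t, x). lin t x + forcing t H)"
      unfolding lin_def forcing_def case_prod_beta'
      by (intro continuous_intros) (auto dest: uh_pos)
    show "norm (lin t x + forcing t H - (lin t y + forcing t H)) \<le> L * norm (x - y)"
      if "t \<in> {0..1}" for t x y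
      using L(2)[OF that, of "x - y"] by (simp add: linear_diff[OF linear_lin])
  qed (use L(1) in blast)+
qed

definition var :: "real \<times> real \<Rightarrow> real \<Rightarrow> real \<times> real" where
  "var H = (SOME V. V 0 = 0 \<and> (\<forall>t\<in>{0..1}.
    (V has_vector_derivative lin t (V t) + forcing t H) (at t within {0..1})))"

lemma var_0: "var H 0 = 0"
  and var_has_derivative: "t \<in> {0..1} \<Longrightarrow>
    (var H has_vector_derivative lin t (var H t) + forcing t H) (at t within {0..1})"
  using someI_ex[OF variation_exists[of H]] by (auto simp: var_def)

text \<open>Superposition: the difference of the two sides solves the homogeneous equation with zero
  initial value. The coefficients on the right are real and do not depend on \<open>'a\<close>, so
  with \<open>'a = complex\<close> the real derivative of \<open>Psi\<close> also describes the
  complex eigenfunctions.\<close>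

lemma forced_solution_eq:
  fixes Z :: "real \<Rightarrow> 'a::real_inner \<times> 'a" and H :: "'a \<times> 'a"
  assumes "Z 0 = 0"
    and Z: "\<And>t. t \<in> {0..1} \<Longrightarrow>
      (Z has_vector_derivative lin t (Z t) + forcing t H) (at t within {0..1})"
    and t: "t \<in> {0..1}"
  shows "Z t = (fst (var (1, 0) t) *\<^sub>R fst H + fst (var (0, 1) t) *\<^sub>R snd H,
                snd (var (1, 0) t) *\<^sub>R fst H + snd (var (0, 1) t) *\<^sub>R snd H)"
proof -
  define F where "F X Y = (fst X *\<^sub>R fst H + fst Y *\<^sub>R snd H, snd X *\<^sub>R fst H + snd Y *\<^sub>R snd H)"
    for X Y :: "real \<times> real"
  have "Z t - F (var (1, 0) t) (var (0, 1) t) = 0"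
  proof (rule lin_ode_unique[OF _ _ t])
    show "Z 0 - F (var (1, 0) 0) (var (0, 1) 0) = 0"
      by (simp add: assms(1) var_0 F_def zero_prod_def)
    fix s :: real assume s: "s \<in> {0..1}"
    have "((\<lambda>t. F (var (1, 0) t) (var (0, 1) t)) has_vector_derivative
        F (lin s (var (1, 0) s) + forcing s (1, 0)) (lin s (var (0, 1) s) + forcing s (0, 1)))
        (at s within {0..1})"
      unfolding F_def
      by (intro has_vector_derivative_Pair has_vector_derivative_add
          bounded_linear.has_vector_derivative[OF bounded_linear_scaleR_left]
          bounded_linear.has_vector_derivative[OF bounded_linear_fst]
          bounded_linear.has_vector_derivative[OF bounded_linear_snd] var_has_derivative s)
    from has_vector_derivative_diff[OF Z[OF s] this]
    have *: "((\<lambda>t. Z t - F (var (1, 0) t) (var (0, 1) t)) has_vector_derivative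
        lin s (Z s) + forcing s H -
        F (lin s (var (1, 0) s) + forcing s (1, 0)) (lin s (var (0, 1) s) + forcing s (0, 1)))
        (at s within {0..1})" .
    have "F (lin s X + forcing s (1, 0)) (lin s Y + forcing s (0, 1)) = lin s (F X Y) + forcing s H"
      for X Y
      by (simp add: F_def lin_def forcing_def algebra_simps)
    then show "((\<lambda>t. Z t - F (var (1, 0) t) (var (0, 1) t)) has_vector_derivative
        lin s (Z s - F (var (1, 0) s) (var (0, 1) s))) (at s within {0..1})"
      using * by (simp add: linear_diff[OF linear_lin])
  qed
  then show ?thesis by (simp add: F_def)
qed

text \<open>The case of real scalars, applied to \<open>var H\<close> itself: although
  \<open>var\<close> is defined by a choice, uniqueness makes it linear in \<open>H\<close>.\<close>

lemma var_eq:
  "t \<in> {0..1} \<Longrightarrow> var H t = fst H *\<^sub>R var (1, 0) t + snd H *\<^sub>R var (0, 1) t"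
  using forced_solution_eq[of "var H" H t, OF var_0 var_has_derivative]
  by (simp add: prod_eq_iff mult.commute)

lemma norm_forcing_le:
  assumes "0 \<le> uh t" "uh t \<le> b"
  shows "norm (forcing t (h $ 1, h $ 2)) \<le> (u0 / \<alpha> + u0 / \<nu> * (1 + b)) * norm (h :: real^2)"
proof (unfold forcing_def fst_conv snd_conv, rule norm_Pair_le_scaled)
  show "norm ((u0 / \<alpha>) *\<^sub>R h $ 1) \<le> u0 / \<alpha> * norm h"
    using pos component_le_norm_cart[of h 1] by (simp add: abs_mult divide_right_mono)
  have "\<bar>h $ 2 - uh t * h $ 1\<bar> \<le> \<bar>h $ 2\<bar> + uh t * \<bar>h $ 1\<bar>"
    using assms by (intro order_trans[OF abs_triangle_ineq4]) (simp add: abs_mult)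
  also have "\<dots> \<le> norm h + b * norm h"
    using assms component_le_norm_cart[of h] by (intro add_mono mult_mono) auto
  finally have "u0 / \<nu> * \<bar>h $ 2 - uh t * h $ 1\<bar> \<le> u0 / \<nu> * (norm h + b * norm h)"
    using pos by (intro mult_left_mono) auto
  then show "norm ((u0 / \<nu>) *\<^sub>R (h $ 2 - uh t *\<^sub>R h $ 1)) \<le> u0 / \<nu> * (1 + b) * norm h"
    using pos by (simp add: abs_mult distrib_left distrib_right)
qed

text \<open>The field is affine in the parameter, so the only errors are those of the quotient
  \<open>e / u\<close>, of the square of \<open>u\<close>, and the mixed term
  \<open>h $ 1 * y\<close>. The radius \<open>a / 2\<close> keeps the perturbed denominator above
  \<open>a / 2\<close>.\<close>

lemma profile_field_expansion:
  fixes h :: "real^2"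
  assumes "0 < a" "a \<le> uh t" "0 < eh t" "eh t \<le> b" "norm z \<le> a / 2"
  shows "norm (profile_field \<Gamma> \<alpha> \<nu> u0 (c + h) ((uh t, eh t) + z)
      - profile_field \<Gamma> \<alpha> \<nu> u0 c (uh t, eh t) - (lin t z + forcing t (h $ 1, h $ 2)))
    \<le> (u0 / \<alpha> * \<Gamma> * (2 * b / a ^ 3 + 2 / a\<^sup>2) + u0 / \<nu>) * ((norm z)\<^sup>2 + (norm h)\<^sup>2)"
proof -
  obtain y w where z: "z = (y, w)" by fastforce
  define u e d where "u = uh t" and "e = eh t" and "d = norm z"
  note defs = u_def[symmetric] e_def[symmetric] d_def[symmetric]
  have d: "\<bar>y\<bar> \<le> d" "\<bar>w\<bar> \<le> d" "0 \<le> d" "d \<le> a / 2"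
    using norm_fst_le[of y w] norm_snd_le[of w y] assms by (auto simp: d_def z)
  have h: "\<bar>h $ 1\<bar> \<le> norm h" by (rule component_le_norm_cart)
  have ue: "0 < u" "a \<le> u" "a / 2 \<le> u + y" "0 < u + y" "0 < e" "e \<le> b" "0 < b"
    using assms d by (auto simp: u_def e_def)
  let ?D = "profile_field \<Gamma> \<alpha> \<nu> u0 (c + h) ((u, e) + z)
      - profile_field \<Gamma> \<alpha> \<nu> u0 c (u, e) - (lin t z + forcing t (h $ 1, h $ 2))"
  have D1: "fst ?D = u0 / \<alpha> * \<Gamma> * (e * y\<^sup>2 / (u\<^sup>2 * (u + y)) - y * w / (u * (u + y)))"
  proof -
    have "(e + w) / (u + y) - e / u - (w / u - e * y / u\<^sup>2)
        = e * y\<^sup>2 / (u\<^sup>2 * (u + y)) - y * w / (u * (u + y))"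
      using ue by (simp add: divide_simps) (simp add: power2_eq_square algebra_simps)
    moreover have "fst ?D = u0 / \<alpha> * \<Gamma> * ((e + w) / (u + y) - e / u - (w / u - e * y / u\<^sup>2))"
      by (simp add: profile_field_def lin_def forcing_def z defs algebra_simps add_divide_distrib)
    ultimately show ?thesis by simp
  qed
  have D2: "snd ?D = u0 / \<nu> * (- (h $ 1 * y) - y\<^sup>2 / 2)"
    by (simp add: profile_field_def lin_def forcing_def z defs power2_eq_square algebra_simps
        add_divide_distrib)
  have "\<bar>e * y\<^sup>2 / (u\<^sup>2 * (u + y)) - y * w / (u * (u + y))\<bar>
      \<le> \<bar>e * y\<^sup>2 / (u\<^sup>2 * (u + y))\<bar> + \<bar>y * w / (u * (u + y))\<bar>"
    by (rule abs_triangle_ineq4)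
  also have "\<dots> = e * \<bar>y\<bar>\<^sup>2 / (u\<^sup>2 * (u + y)) + \<bar>y\<bar> * \<bar>w\<bar> / (u * (u + y))"
    using ue by (simp add: abs_mult)
  also have "\<dots> \<le> b * d\<^sup>2 / (a\<^sup>2 * (a / 2)) + d * d / (a * (a / 2))"
    using ue d assms(1) by (intro add_mono frac_le mult_mono power_mono mult_nonneg_nonneg) auto
  also have "\<dots> = (2 * b / a ^ 3 + 2 / a\<^sup>2) * d\<^sup>2"
    by (simp add: power2_eq_square power3_eq_cube algebra_simps)
  also have "\<dots> \<le> (2 * b / a ^ 3 + 2 / a\<^sup>2) * (d\<^sup>2 + (norm h)\<^sup>2)"
    using ue assms(1) by (intro mult_left_mono) auto
  finally have "u0 / \<alpha> * \<Gamma> * \<bar>e * y\<^sup>2 / (u\<^sup>2 * (u + y)) - y * w / (u * (u + y))\<bar>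
      \<le> u0 / \<alpha> * \<Gamma> * ((2 * b / a ^ 3 + 2 / a\<^sup>2) * (d\<^sup>2 + (norm h)\<^sup>2))"
    using pos by (intro mult_left_mono) auto
  then have 1: "norm (fst ?D) \<le> u0 / \<alpha> * \<Gamma> * (2 * b / a ^ 3 + 2 / a\<^sup>2) * (d\<^sup>2 + (norm h)\<^sup>2)"
    unfolding D1 using pos by (simp add: abs_mult mult.assoc)
  have "\<bar>- (h $ 1 * y) - y\<^sup>2 / 2\<bar> \<le> \<bar>h $ 1\<bar> * \<bar>y\<bar> + \<bar>y\<bar>\<^sup>2 / 2"
    using abs_triangle_ineq4[of "- (h $ 1 * y)" "y\<^sup>2 / 2"] by (simp add: abs_mult)
  also have "\<dots> \<le> norm h * d + d\<^sup>2 / 2"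
    using d h by (intro add_mono mult_mono divide_right_mono power_mono) auto
  also have "\<dots> \<le> d\<^sup>2 + (norm h)\<^sup>2"
    using sum_squares_bound[of "norm h" d] zero_le_power2[of "norm h"]
    by (simp only: power2_eq_square)
  finally have "u0 / \<nu> * \<bar>- (h $ 1 * y) - y\<^sup>2 / 2\<bar> \<le> u0 / \<nu> * (d\<^sup>2 + (norm h)\<^sup>2)"
    using pos by (intro mult_left_mono) auto
  then have 2: "norm (snd ?D) \<le> u0 / \<nu> * (d\<^sup>2 + (norm h)\<^sup>2)"
    unfolding D2 using pos by (simp add: abs_mult)
  show ?thesis
    using norm_Pair_le_scaled[OF 1 2] by (simp only: prod.collapse defs)
qed

lemma Psi_has_derivative:
  "(Psi \<Gamma> \<alpha> \<nu> u0 e0 has_derivative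
     (\<lambda>h. vector [fst (var (h $ 1, h $ 2) 1), snd (var (h $ 1, h $ 2) 1)])) (at c)"
proof -
  obtain a b where a: "0 < a"
    and ab: "\<And>t. t \<in> {0..1} \<Longrightarrow> a \<le> uh t \<and> uh t \<le> b \<and> a \<le> eh t \<and> eh t \<le> b"
    using profile_bounds[OF profile] by blast
  have b: "a \<le> b" using ab[of 0] by simp
  let ?f = "profile_field \<Gamma> \<alpha> \<nu> u0"
  \<comment> \<open>The field for the deviation from the given profile when the parameter is
    \<open>c + h\<close>.\<close>
  define g where "g h t z = ?f (c + h) ((uh t, eh t) + z) - ?f c (uh t, eh t)" for h t z
  \<comment> \<open>Within distance \<open>a / 2\<close> of the profile the components lie between
    \<open>a / 2\<close> and \<open>2 * b\<close>, and
    \<open>\<bar>h $ 1\<bar> \<le> a / 2 \<le> b\<close>. The expansion lemma takes a single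
    constant, for which the sum of \<open>L1\<close>, \<open>L2\<close> and \<open>L3\<close> is
    used.\<close>
  define L1 where "L1 = u0 / \<alpha> * (1 + \<Gamma> * (1 / (a / 2) + 2 * b / (a / 2)\<^sup>2))
      + u0 / \<nu> * (\<bar>c $ 1\<bar> + b + 2 * b + 1)"
  define L2 where "L2 = u0 / \<alpha> * (1 + \<Gamma> * (1 / a + b / a\<^sup>2)) + u0 / \<nu> * (1 + (\<bar>c $ 1\<bar> + b))"
  define L3 where "L3 = u0 / \<alpha> + u0 / \<nu> * (1 + b)"
  define K where "K = u0 / \<alpha> * \<Gamma> * (2 * b / a ^ 3 + 2 / a\<^sup>2) + u0 / \<nu>"
  have L: "0 \<le> L1" "0 \<le> L2" "0 \<le> L3" "0 \<le> K"
    using pos a b by (auto simp: L1_def L2_def L3_def K_def)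
  have small: "a / 2 \<le> uh t + fst z" "uh t + fst z \<le> 2 * b" "a / 2 \<le> eh t + snd z"
    "eh t + snd z \<le> 2 * b" if "t \<in> {0..1}" "norm z \<le> a / 2" for t and z :: "real \<times> real"
    using ab[OF that(1)] that(2) b norm_fst_le[of "fst z" "snd z"] norm_snd_le[of "snd z" "fst z"]
    by (auto simp: abs_le_iff)
  obtain \<eta> C where \<eta>: "0 < \<eta>"
    and sol: "\<And>h :: real^2. norm h \<le> \<eta> \<Longrightarrow> \<exists>z. z 0 = 0 \<and> (\<forall>t\<in>{0..1}. norm (z t) \<le> a / 2 \<and>
           (z has_vector_derivative g h t (z t)) (at t within {0..1})) \<and>
           norm (z 1 - var (h $ 1, h $ 2) 1) \<le> C * (norm h)\<^sup>2"
  proof (rule ode_solution_parameter_expansion[of "a / 2" "L1 + L2 + L3" K g lin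
        "\<lambda>t h. forcing t (h $ 1, h $ 2)" "\<lambda>h. var (h $ 1, h $ 2)"])
    fix h :: "real^2" assume h: "norm h \<le> a / 2"
    have "continuous_on ({0..1} \<times> cball (0 :: real \<times> real) (a / 2)) (\<lambda>q. uh (fst q))"
      "continuous_on ({0..1} \<times> cball (0 :: real \<times> real) (a / 2)) (\<lambda>q. eh (fst q))"
      by (auto intro!: continuous_intros continuous_on_compose2[OF profile_continuous(1)[OF profile]]
            continuous_on_compose2[OF profile_continuous(2)[OF profile]])
    moreover have "uh (fst q) + fst (snd q) \<noteq> 0" "uh (fst q) \<noteq> 0"
      if "q \<in> {0..1} \<times> cball (0 :: real \<times> real) (a / 2)" for q
      using small(1)[of "fst q" "snd q"] that a uh_pos[of "fst q"] by auto
    ultimately show "continuous_on ({0..1} \<times> cball 0 (a / 2)) (\<lambda>(t, z). g h t z)"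
      unfolding g_def profile_field_def case_prod_beta' fst_conv snd_conv fst_add snd_add
      by (intro continuous_intros) auto
  next
    fix h :: "real^2" and t :: real and z w :: "real \<times> real"
    assume h: "norm h \<le> a / 2" and t: "t \<in> {0..1}" and z: "norm z \<le> a / 2" and w: "norm w \<le> a / 2"
    have "\<bar>(c + h) $ 1\<bar> \<le> \<bar>c $ 1\<bar> + b"
      using component_le_norm_cart[of h 1] h a b unfolding vector_add_component by linarith
    then have "norm (g h t z - g h t w) \<le> L1 * norm (z - w)"
      unfolding g_def L1_def
      using small[OF t z] small[OF t w] a b
        profile_field_lipschitz[OF pos, of "a / 2" "(uh t, eh t) + z" "2 * b" "(uh t, eh t) + w"
          "c + h" "\<bar>c $ 1\<bar> + b"]
      by simp
    also have "\<dots> \<le> (L1 + L2 + L3) * norm (z - w)"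
      using L by (intro mult_right_mono) auto
    finally show "norm (g h t z - g h t w) \<le> (L1 + L2 + L3) * norm (z - w)" .
  next
    fix t :: real and z :: "real \<times> real" assume t: "t \<in> {0..1}"
    have "norm (lin t z) \<le> L2 * norm z"
      unfolding L2_def using ab[OF t] eh_pos[OF t] a by (intro norm_lin_le) auto
    also have "\<dots> \<le> (L1 + L2 + L3) * norm z"
      using L by (intro mult_right_mono) auto
    finally show "norm (lin t z) \<le> (L1 + L2 + L3) * norm z" .
  next
    fix t :: real and h :: "real^2" assume t: "t \<in> {0..1}"
    have "norm (forcing t (h $ 1, h $ 2)) \<le> L3 * norm h"
      unfolding L3_def using ab[OF t] a by (intro norm_forcing_le) auto
    also have "\<dots> \<le> (L1 + L2 + L3) * norm h"
      using L by (intro mult_right_mono) auto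
    finally show "norm (forcing t (h $ 1, h $ 2)) \<le> (L1 + L2 + L3) * norm h" .
  next
    fix h :: "real^2" and t :: real and z :: "real \<times> real"
    assume "t \<in> {0..1}" "norm z \<le> a / 2"
    then show "norm (g h t z - (lin t z + forcing t (h $ 1, h $ 2))) \<le> K * ((norm z)\<^sup>2 + (norm h)\<^sup>2)"
      unfolding g_def K_def using ab eh_pos a by (intro profile_field_expansion) auto
  qed (use a L linear_lin var_0 var_has_derivative in auto)
  show ?thesis
  proof (rule has_derivative_quadratic_remainder[OF _ \<eta>])
    have v: "var (h $ 1, h $ 2) 1 = h $ 1 *\<^sub>R var (1, 0) 1 + h $ 2 *\<^sub>R var (0, 1) 1"
      for h :: "real^2"
      using var_eq[of 1 "(h $ 1, h $ 2)"] by simp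
    have "linear (\<lambda>h :: real^2. fst (var (h $ 1, h $ 2) 1))"
      "linear (\<lambda>h :: real^2. snd (var (h $ 1, h $ 2) 1))"
      unfolding v by (auto intro!: linearI simp: algebra_simps)
    then show "bounded_linear (\<lambda>h :: real^2.
        vector [fst (var (h $ 1, h $ 2) 1), snd (var (h $ 1, h $ 2) 1)] :: real^2)"
      by (intro linear_conv_bounded_linear[THEN iffD1] linear_vector_2)
    fix h :: "real^2" assume "norm h \<le> \<eta>"
    then obtain z where z0: "z 0 = 0" and zr: "\<And>t. t \<in> {0..1} \<Longrightarrow> norm (z t) \<le> a / 2"
      and zd: "\<And>t. t \<in> {0..1} \<Longrightarrow> (z has_vector_derivative g h t (z t)) (at t within {0..1})"
      and z1: "norm (z 1 - var (h $ 1, h $ 2) 1) \<le> C * (norm h)\<^sup>2"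
      using sol by blast
    \<comment> \<open>This makes \<open>c + h\<close> feasible, so that \<open>Psi\<close> at
      \<open>c + h\<close> is the end value of the perturbed profile and not an unspecified
      value.\<close>
    have prof: "is_profile \<Gamma> \<alpha> \<nu> u0 e0 (c + h) (\<lambda>t. uh t + fst (z t)) (\<lambda>t. eh t + snd (z t))"
      unfolding is_profile_iff[OF pos(2-4)]
    proof (intro conjI ballI)
      fix t :: real assume t: "t \<in> {0..1}"
      show "0 < uh t + fst (z t)" "0 < eh t + snd (z t)"
        using small[OF t zr[OF t]] a by auto
      have "((\<lambda>t. (uh t, eh t)) has_vector_derivative ?f c (uh t, eh t)) (at t within {0..1})"
        using profile t unfolding is_profile_iff[OF pos(2-4)] by blast
      from has_vector_derivative_add[OF this zd[OF t]]
      show "((\<lambda>t. (uh t + fst (z t), eh t + snd (z t))) has_vector_derivative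
          ?f (c + h) (uh t + fst (z t), eh t + snd (z t))) (at t within {0..1})"
        by (simp add: g_def plus_prod_def)
    qed (use profile z0 in \<open>auto simp: is_profile_def\<close>)
    have w: "\<bar>fst w\<bar> + \<bar>snd w\<bar> \<le> 2 * norm w" for w :: "real \<times> real"
      using norm_fst_le[of "fst w" "snd w"] norm_snd_le[of "snd w" "fst w"] by simp
    from Psi_eq[OF pos prof] Psi_eq[OF pos profile]
    have "norm (Psi \<Gamma> \<alpha> \<nu> u0 e0 (c + h) - Psi \<Gamma> \<alpha> \<nu> u0 e0 c
        - vector [fst (var (h $ 1, h $ 2) 1), snd (var (h $ 1, h $ 2) 1)])
        \<le> \<bar>fst (z 1 - var (h $ 1, h $ 2) 1)\<bar> + \<bar>snd (z 1 - var (h $ 1, h $ 2) 1)\<bar>"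
      by (intro order_trans[OF norm_le_l1_cart]) (simp add: sum_2)
    also have "\<dots> \<le> 2 * norm (z 1 - var (h $ 1, h $ 2) 1)"
      by (rule w)
    also have "\<dots> \<le> 2 * C * (norm h)\<^sup>2" using z1 by simp
    finally show "norm (Psi \<Gamma> \<alpha> \<nu> u0 e0 (c + h) - Psi \<Gamma> \<alpha> \<nu> u0 e0 c
        - vector [fst (var (h $ 1, h $ 2) 1), snd (var (h $ 1, h $ 2) 1)]) \<le> 2 * C * (norm h)\<^sup>2" .
  qed
qed

lemma det_jacobian_Psi:
  "Psi \<Gamma> \<alpha> \<nu> u0 e0 differentiable (at c)"
  "det (jacobian (Psi \<Gamma> \<alpha> \<nu> u0 e0) (at c))
     = fst (var (1, 0) 1) * snd (var (0, 1) 1) - fst (var (0, 1) 1) * snd (var (1, 0) 1)"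
proof -
  show "Psi \<Gamma> \<alpha> \<nu> u0 e0 differentiable (at c)"
    using Psi_has_derivative by (rule differentiableI)
  have "frechet_derivative (Psi \<Gamma> \<alpha> \<nu> u0 e0) (at c)
      = (\<lambda>h. vector [fst (var (h $ 1, h $ 2) 1), snd (var (h $ 1, h $ 2) 1)])"
    using frechet_derivative_at[OF Psi_has_derivative] by simp
  then show "det (jacobian (Psi \<Gamma> \<alpha> \<nu> u0 e0) (at c))
     = fst (var (1, 0) 1) * snd (var (0, 1) 1) - fst (var (0, 1) 1) * snd (var (1, 0) 1)"
    by (simp add: det_2 jacobian_def matrix_def axis_def)
qed

end

subsection \<open>The Evans function at zero\<close>

lemma differentiable_on_of_real:
  fixes f :: "real \<Rightarrow> real"
  assumes "f differentiable_on {0..1}"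
  shows "(\<lambda>t. complex_of_real (f t)) differentiable_on {0..1}"
  by (rule differentiable_onI_vector)
    (rule bounded_linear.has_vector_derivative[OF bounded_linear_of_real has_dx[OF assms]])

lemma differentiable_on_eq:
  assumes "f differentiable_on {0..1}" "\<And>t. t \<in> {0..1::real} \<Longrightarrow> g t = f t"
  shows "g differentiable_on {0..1}"
  by (rule differentiable_onI_vector)
    (rule has_vector_derivative_transform[OF _ assms(2) has_dx[OF assms(1)]])

text \<open>Carries out the integration in \<open>x\<close> without an integral: the difference has
  zero derivative on a convex set, so the derivatives need not be continuous.\<close>

lemma eq_dx_imp_eq_diff:
  assumes f: "f differentiable_on {0..1}" and g: "g differentiable_on {0..1}"
    and "\<And>t. t \<in> {0..1} \<Longrightarrow> dx f t = dx g t" and "t \<in> {0..1}"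
  shows "f t - g t = f 0 - g 0"
proof (rule has_derivative_zero_unique[of "{0..1}" "\<lambda>t. f t - g t"])
  show "((\<lambda>t. f t - g t) has_derivative (\<lambda>h. 0)) (at s within {0..1})" if "s \<in> {0..1}" for s
    using has_vector_derivative_diff[OF has_dx[OF f that] has_dx[OF g that]] assms(3)[OF that]
    by (simp add: has_vector_derivative_def)
qed (use assms(4) in auto)

text \<open>The linearized energy equation at \<open>\<lambda> = 0\<close> is a total derivative once the momentum equations
  for the profile and for the perturbation are inserted into the two halves of the viscous term.\<close>

lemma energy_identity:
  fixes A G k U E U' u e u' e' a \<kappa> :: "'a::field"
  assumes "U \<noteq> 0"
    and "A * U' = k * (\<kappa> + U + G * (E / U))"
    and "A * u' = k * (u + G * (e / U - E / U\<^sup>2 * u)) + k * a"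
  shows "k * e' + G * (k / U) * E * u' + G * U' * (k / U * e + E * (- (k / U\<^sup>2) * u)) - 2 * A * U' * u'
    = k * (e' - (\<kappa> + U) * u' - U' * u - U' * a)"
proof -
  have "2 * A * U' * u' = (A * U') * u' + U' * (A * u')" by (simp add: algebra_simps)
  then show ?thesis unfolding assms(2,3) by (simp add: algebra_simps)
qed

section \<open>Integrating the eigenvalue system at zero\<close>

locale steady_state = steady_profile +
  fixes rh :: "real \<Rightarrow> real"
  assumes rh: "t \<in> {0..1} \<Longrightarrow> rh t = u0 / uh t"
begin

text \<open>Linearization at the profile of \<open>u0 * (u + \<Gamma> * e / u)\<close>, the
  nonconstant part of the right-hand side for \<open>\<alpha> * u'\<close>.\<close>

definition flux :: "(real \<Rightarrow> complex) \<Rightarrow> (real \<Rightarrow> complex) \<Rightarrow> real \<Rightarrow> complex" where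
  "flux u e t = of_real u0 * (u t + of_real \<Gamma> *
     (e t / of_real (uh t) - of_real (eh t) / (of_real (uh t))\<^sup>2 * u t))"

text \<open>Linearization of the right-hand side for \<open>\<nu> * e'\<close>, up to the constant
  from the increment of \<open>c $ 2\<close>. The increment \<open>a\<close> of \<open>c $ 1\<close>
  occurs because \<open>c $ 1\<close> multiplies \<open>u\<close> there.\<close>

definition heat :: "complex \<Rightarrow> (real \<Rightarrow> complex) \<Rightarrow> (real \<Rightarrow> complex) \<Rightarrow> real \<Rightarrow> complex" where
  "heat a u e t = of_real u0 * (e t - of_real (c $ 1 + uh t) * u t - of_real (uh t) * a)"

lemma uh_differentiable: "uh differentiable_on {0..1}"
  and eh_differentiable: "eh differentiable_on {0..1}"
  using profile by (auto simp: is_profile_def)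

lemma rh_differentiable: "rh differentiable_on {0..1}"
proof (rule differentiable_on_eq[OF _ rh])
  show "(\<lambda>t. u0 / uh t) differentiable_on {0..1}"
    using uh_differentiable uh_pos unfolding differentiable_on_def
    by (auto intro!: differentiable_divide) (metis atLeastAtMost_iff less_irrefl)
qed

lemma flux_differentiable:
  assumes "u differentiable_on {0..1}" "e differentiable_on {0..1}"
  shows "flux u e differentiable_on {0..1}"
  using assms differentiable_on_of_real[OF uh_differentiable]
    differentiable_on_of_real[OF eh_differentiable] uh_pos
  unfolding flux_def differentiable_on_def
  by (fastforce intro!: differentiable_divide differentiable_mult differentiable_add
      differentiable_diff differentiable_power)

lemma heat_has_derivative:
  assumes "u differentiable_on {0..1}" "e differentiable_on {0..1}" "t \<in> {0..1}"
  shows "(heat a u e has_vector_derivative of_real u0 * (dx e t - of_real (c $ 1 + uh t) * dx u t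
    - of_real (dx uh t) * u t - of_real (dx uh t) * a)) (at t within {0..1})"
proof -
  have cu: "((\<lambda>t. complex_of_real (c $ 1 + uh t)) has_vector_derivative of_real (dx uh t))
      (at t within {0..1})"
    using bounded_linear.has_vector_derivative[OF bounded_linear_of_real
        has_vector_derivative_add[OF has_vector_derivative_const has_dx[OF uh_differentiable assms(3)]]]
    by simp
  have u: "((\<lambda>t. complex_of_real (uh t)) has_vector_derivative of_real (dx uh t))
      (at t within {0..1})"
    by (rule bounded_linear.has_vector_derivative[OF bounded_linear_of_real
        has_dx[OF uh_differentiable assms(3)]])
  have "(heat a u e has_vector_derivative of_real u0 * (dx e t
      - (of_real (c $ 1 + uh t) * dx u t + of_real (dx uh t) * u t) - of_real (dx uh t) * a))
      (at t within {0..1})"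
    unfolding heat_def
    by (intro has_vector_derivative_mult_right has_vector_derivative_diff
        has_vector_derivative_mult_left has_vector_derivative_mult cu u has_dx assms)
  then show ?thesis by (simp add: algebra_simps)
qed

lemma forced_components:
  "of_real \<alpha> * fst (lin t (u t, e t) + forcing t (a, k)) = flux u e t + of_real u0 * a"
  "of_real \<nu> * snd (lin t (u t, e t) + forcing t (a, k)) = heat a u e t + of_real u0 * k"
  using pos by (simp_all add: lin_def forcing_def flux_def heat_def scaleR_conv_of_real algebra_simps)

lemma profile_momentum:
  "t \<in> {0..1} \<Longrightarrow> of_real \<alpha> * complex_of_real (dx uh t)
     = of_real u0 * (of_real (c $ 1) + of_real (uh t) + of_real \<Gamma> * (of_real (eh t) / of_real (uh t)))"
proof -
  assume "t \<in> {0..1}"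
  then have "\<alpha> / u0 * dx uh t = c $ 1 + uh t + \<Gamma> * (eh t / uh t)"
    using profile by (simp add: is_profile_def)
  then have "\<alpha> * dx uh t = u0 * (c $ 1 + uh t + \<Gamma> * (eh t / uh t))"
    using pos by (simp add: field_simps)
  then show ?thesis by (metis of_real_add of_real_divide of_real_mult)
qed

text \<open>At \<open>\<lambda> = 0\<close> the continuity equation and \<open>\<rho> 0 = u 0 = 0\<close> give \<open>\<rho> = - (rh / uh) u\<close>; under this
  relation the remaining two equations read \<open>\<alpha> u'' = flux'\<close> and \<open>\<nu> e'' = heat'\<close>.\<close>

lemma momentum_term_eq_flux:
  assumes "t \<in> {0..1}" "\<rho> t = - of_real (u0 / (uh t)\<^sup>2) * u t"
  shows "of_real (rh t * uh t) * u t + of_real (\<Gamma> * rh t) * e t + of_real (\<Gamma> * eh t) * \<rho> t = flux u e t"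
  unfolding rh[OF assms(1)] assms(2) flux_def
  using uh_pos[OF assms(1)] by (simp add: field_simps power2_eq_square)

text \<open>The integrated momentum equation is a hypothesis since the viscous heating is a total
  derivative only after it is inserted; its constant \<open>a\<close> thereby enters
  \<open>heat\<close>. The convection term with \<open>dx eh\<close> is absent because the perturbed
  mass flux vanishes.\<close>

lemma energy_term_eq_heat:
  assumes t: "t \<in> {0..1}" and \<rho>: "\<rho> t = - of_real (u0 / (uh t)\<^sup>2) * u t"
    and u: "u differentiable_on {0..1}" and e: "e differentiable_on {0..1}"
    and mom: "of_real \<alpha> * dx u t = flux u e t + of_real u0 * a"
  shows "dx (\<lambda>y. of_real (rh y * uh y) * e y) t + of_real (\<Gamma> * rh t * eh t) * dx u t
      + of_real (\<Gamma> * dx uh t) * (of_real (rh t) * e t + of_real (eh t) * \<rho> t)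
      - of_real (2 * \<alpha> * dx uh t) * dx u t = dx (heat a u e) t"
proof -
  have "dx (\<lambda>y. of_real (rh y * uh y) * e y) t = dx (\<lambda>y. of_real u0 * e y) t"
    using uh_pos by (intro dx_cong t) (auto simp: rh less_imp_neq[symmetric])
  also have "\<dots> = of_real u0 * dx e t"
    by (intro dx_eqI t has_vector_derivative_mult_right has_dx e)
  finally have 1: "dx (\<lambda>y. of_real (rh y * uh y) * e y) t = of_real u0 * dx e t" .
  have 2: "dx (heat a u e) t = of_real u0 * (dx e t - (of_real (c $ 1) + of_real (uh t)) * dx u t
    - of_real (dx uh t) * u t - of_real (dx uh t) * a)"
    using dx_eqI[OF t heat_has_derivative[OF u e t]] by simp
  show ?thesis
    unfolding 1 2
    using energy_identity[OF _ profile_momentum[OF t] mom[unfolded flux_def], of "dx e t"] uh_pos[OF t]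
    by (simp add: rh[OF t] \<rho>)
qed

lemma eigen_solution_imp_forced:
  assumes sol: "eigen_solution \<Gamma> \<alpha> \<nu> rh uh eh 0 \<rho> u e"
    and init: "\<rho> 0 = 0" "u 0 = 0" "e 0 = 0" and t: "t \<in> {0..1}"
  defines "a \<equiv> of_real (\<alpha> / u0) * dx u 0"
    and "k \<equiv> of_real (\<nu> / u0) * dx e 0 + of_real \<alpha> * dx u 0"
  shows "((\<lambda>t. (u t, e t)) has_vector_derivative lin t (u t, e t) + forcing t (a, k))
    (at t within {0..1})"
proof -
  note eqs = bspec[OF sol[unfolded eigen_solution_def, THEN conjunct2, THEN conjunct2,
        THEN conjunct2, THEN conjunct2, THEN conjunct2]]
  have d: "\<rho> differentiable_on {0..1}" "u differentiable_on {0..1}" "dx u differentiable_on {0..1}"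
    "e differentiable_on {0..1}" "dx e differentiable_on {0..1}"
    using sol by (auto simp: eigen_solution_def)
  have u0: "complex_of_real u0 \<noteq> 0" using pos by simp
  \<comment> \<open>At zero the continuity equation says that the perturbed mass flux is constant,
    and it starts from 0.\<close>
  have mass: "of_real (rh s) * u s + of_real (uh s) * \<rho> s = 0" if s: "s \<in> {0..1}" for s
  proof -
    have "(\<lambda>y. of_real (rh y) * u y + of_real (uh y) * \<rho> y) differentiable_on {0..1}"
      by (intro differentiable_on_add differentiable_on_mult differentiable_on_of_real
          rh_differentiable uh_differentiable d)
    moreover have "dx (\<lambda>y. of_real (rh y) * u y + of_real (uh y) * \<rho> y) y = dx (\<lambda>y. 0) y"
      if "y \<in> {0..1}" for y
      using eqs[OF that] dx_eqI[OF that has_vector_derivative_const[of 0]] by simp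
    ultimately show ?thesis
      using eq_dx_imp_eq_diff[of "\<lambda>y. of_real (rh y) * u y + of_real (uh y) * \<rho> y" "\<lambda>_. 0" s] s init
      by simp
  qed
  have \<rho>: "\<rho> s = - of_real (u0 / (uh s)\<^sup>2) * u s" if "s \<in> {0..1}" for s
    using mass[OF that] uh_pos[OF that]
    by (simp add: rh[OF that] field_simps power2_eq_square eq_neg_iff_add_eq_0)
  have mom: "of_real \<alpha> * dx u s = flux u e s + of_real u0 * a" if s: "s \<in> {0..1}" for s
  proof -
    have "dx (\<lambda>y. of_real \<alpha> * dx u y) y = dx (flux u e) y" if y: "y \<in> {0..1}" for y
    proof -
      have "dx (\<lambda>y. of_real \<alpha> * dx u y) y = of_real \<alpha> * dx (dx u) y"
        by (intro dx_eqI y has_vector_derivative_mult_right has_dx d)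
      also have "\<dots> = dx (\<lambda>y. of_real (rh y * uh y) * u y + of_real (\<Gamma> * rh y) * e y
          + of_real (\<Gamma> * eh y) * \<rho> y) y"
        using eqs[OF y] mass[OF y] by simp
      also have "\<dots> = dx (flux u e) y"
        by (intro dx_cong y momentum_term_eq_flux \<rho>)
      finally show ?thesis .
    qed
    then have "of_real \<alpha> * dx u s - flux u e s = of_real \<alpha> * dx u 0 - flux u e 0"
      by (intro eq_dx_imp_eq_diff flux_differentiable differentiable_on_mult d s) auto
    then show ?thesis
      using u0 init by (simp add: flux_def a_def algebra_simps)
  qed
  have energy: "of_real \<nu> * dx e s = heat a u e s + of_real u0 * k" if s: "s \<in> {0..1}" for s
  proof -
    have "dx (\<lambda>y. of_real \<nu> * dx e y) y = dx (heat a u e) y" if y: "y \<in> {0..1}" for y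
    proof -
      have "dx (\<lambda>y. of_real \<nu> * dx e y) y = of_real \<nu> * dx (dx e) y"
        by (intro dx_eqI y has_vector_derivative_mult_right has_dx d)
      also have "\<dots> = dx (\<lambda>y. of_real (rh y * uh y) * e y) y + of_real (\<Gamma> * rh y * eh y) * dx u y
          + of_real (\<Gamma> * dx uh y) * (of_real (rh y) * e y + of_real (eh y) * \<rho> y)
          - of_real (2 * \<alpha> * dx uh y) * dx u y"
        using eqs[OF y] mass[OF y] by simp
      also have "\<dots> = dx (heat a u e) y"
        by (intro energy_term_eq_heat y \<rho> d mom)
      finally show ?thesis .
    qed
    moreover have "heat a u e differentiable_on {0..1}"
      by (rule differentiable_onI_vector[OF heat_has_derivative[OF d(2,4)]])
    ultimately have "of_real \<nu> * dx e s - heat a u e s = of_real \<nu> * dx e 0 - heat a u e 0"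
      by (intro eq_dx_imp_eq_diff differentiable_on_mult d s) auto
    \<comment> \<open>Since \<open>uh 0 = u0\<close>, \<open>heat\<close> at 0 equals
      \<open>- (u0 * u0 * a)\<close>, and \<open>u0 * a\<close> is \<open>\<alpha> * u'(0)\<close>:
      this is the second summand of \<open>k\<close>.\<close>
    then show ?thesis
      using u0 init by (simp add: heat_def a_def k_def uh_0 algebra_simps)
  qed
  have "lin t (u t, e t) + forcing t (a, k) = (dx u t, dx e t)"
    using forced_components[of t u e a k] mom[OF t] energy[OF t] pos
    by (metis less_irrefl mult_left_cancel of_real_eq_0_iff prod.collapse)
  then show ?thesis
    using has_vector_derivative_Pair[OF has_dx[OF d(2) t] has_dx[OF d(4) t]] by simp
qed

text \<open>The converse direction, which supplies the existence half of \<open>Evans\<close>;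
  \<open>\<rho>\<close> is dictated by the vanishing of the perturbed mass flux.\<close>

lemma forced_imp_eigen_solution:
  fixes u e :: "real \<Rightarrow> complex"
  assumes Z: "\<And>t. t \<in> {0..1} \<Longrightarrow>
      ((\<lambda>t. (u t, e t)) has_vector_derivative lin t (u t, e t) + forcing t (a, k)) (at t within {0..1})"
  defines "\<rho> \<equiv> (\<lambda>t. - of_real (u0 / (uh t)\<^sup>2) * u t)"
  shows "eigen_solution \<Gamma> \<alpha> \<nu> rh uh eh 0 \<rho> u e"
    and "t \<in> {0..1} \<Longrightarrow> of_real \<alpha> * dx u t = flux u e t + of_real u0 * a"
    and "t \<in> {0..1} \<Longrightarrow> of_real \<nu> * dx e t = heat a u e t + of_real u0 * k"
proof -
  have u': "(u has_vector_derivative fst (lin t (u t, e t) + forcing t (a, k))) (at t within {0..1})"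
    if "t \<in> {0..1}" for t
    using bounded_linear.has_vector_derivative[OF bounded_linear_fst Z[OF that]] by simp
  have e': "(e has_vector_derivative snd (lin t (u t, e t) + forcing t (a, k))) (at t within {0..1})"
    if "t \<in> {0..1}" for t
    using bounded_linear.has_vector_derivative[OF bounded_linear_snd Z[OF that]] by simp
  show mom: "of_real \<alpha> * dx u t = flux u e t + of_real u0 * a" if "t \<in> {0..1}" for t
    using dx_eqI[OF that u'[OF that]] forced_components(1) by metis
  show energy: "of_real \<nu> * dx e t = heat a u e t + of_real u0 * k" if "t \<in> {0..1}" for t
    using dx_eqI[OF that e'[OF that]] forced_components(2) by metis
  have u: "u differentiable_on {0..1}" and e: "e differentiable_on {0..1}"
    using differentiable_onI_vector[OF u'] differentiable_onI_vector[OF e'] by auto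
  have flux: "flux u e differentiable_on {0..1}" by (rule flux_differentiable[OF u e])
  have heat: "heat a u e differentiable_on {0..1}"
    by (rule differentiable_onI_vector[OF heat_has_derivative[OF u e]])
  \<comment> \<open>Gain of regularity: the first-order equation expresses \<open>dx u\<close>
    through differentiable functions, so a second derivative exists; likewise for
    \<open>dx e\<close>.\<close>
  have dxu: "dx u t = inverse (of_real \<alpha>) * (flux u e t + of_real u0 * a)" if "t \<in> {0..1}" for t
    using mom[OF that] pos by (simp add: field_simps)
  have dxe: "dx e t = inverse (of_real \<nu>) * (heat a u e t + of_real u0 * k)" if "t \<in> {0..1}" for t
    using energy[OF that] pos by (simp add: field_simps)
  have dxu_diff: "dx u differentiable_on {0..1}"
    by (rule differentiable_on_eq[OF _ dxu]) (auto intro!: differentiable_on_mult differentiable_on_add flux)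
  have dxe_diff: "dx e differentiable_on {0..1}"
    by (rule differentiable_on_eq[OF _ dxe]) (auto intro!: differentiable_on_mult differentiable_on_add heat)
  have \<rho>_eq: "\<rho> t = - of_real (u0 / (uh t)\<^sup>2) * u t" for t
    by (simp add: \<rho>_def)
  have \<rho>: "\<rho> differentiable_on {0..1}"
  proof -
    have "(\<lambda>t. u0 / (uh t)\<^sup>2) differentiable_on {0..1}"
      using uh_differentiable uh_pos unfolding differentiable_on_def
      by (fastforce intro!: differentiable_divide differentiable_power)
    then show ?thesis
      unfolding \<rho>_def
      by (intro differentiable_on_mult differentiable_on_minus differentiable_on_of_real u)
  qed
  have mass: "of_real (rh t) * u t + of_real (uh t) * \<rho> t = 0" if "t \<in> {0..1}" for t
    using uh_pos[OF that] by (simp add: rh[OF that] \<rho>_def field_simps power2_eq_square)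
  show "eigen_solution \<Gamma> \<alpha> \<nu> rh uh eh 0 \<rho> u e"
    unfolding eigen_solution_def
  proof (intro conjI ballI)
    fix t :: real assume t: "t \<in> {0..1}"
    have "dx (\<lambda>y. of_real (rh y) * u y + of_real (uh y) * \<rho> y) t = dx (\<lambda>y. 0) t"
      by (intro dx_cong t mass)
    then show "0 * \<rho> t + dx (\<lambda>y. of_real (rh y) * u y + of_real (uh y) * \<rho> y) t = 0"
      using dx_eqI[OF t has_vector_derivative_const[of 0]] by simp
    have "dx (\<lambda>y. of_real (rh y * uh y) * u y + of_real (\<Gamma> * rh y) * e y + of_real (\<Gamma> * eh y) * \<rho> y) t
        = dx (flux u e) t"
      by (intro dx_cong t momentum_term_eq_flux \<rho>_eq)
    moreover have "dx (dx u) t = dx (\<lambda>t. inverse (of_real \<alpha>) * (flux u e t + of_real u0 * a)) t"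
      by (intro dx_cong t dxu)
    moreover have "dx (\<lambda>t. inverse (of_real \<alpha>) * (flux u e t + of_real u0 * a)) t
        = inverse (of_real \<alpha>) * (dx (flux u e) t + 0)"
      by (intro dx_eqI t has_vector_derivative_mult_right has_vector_derivative_add
          has_vector_derivative_const has_dx flux)
    ultimately show "0 * of_real (rh t) * u t
        + dx (\<lambda>y. of_real (rh y * uh y) * u y + of_real (\<Gamma> * rh y) * e y + of_real (\<Gamma> * eh y) * \<rho> y) t
        + of_real (dx uh t) * (of_real (rh t) * u t + of_real (uh t) * \<rho> t)
        = of_real \<alpha> * dx (dx u) t"
      using pos mass[OF t] by simp
    have "dx (dx e) t = dx (\<lambda>t. inverse (of_real \<nu>) * (heat a u e t + of_real u0 * k)) t"
      by (intro dx_cong t dxe)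
    moreover have "dx (\<lambda>t. inverse (of_real \<nu>) * (heat a u e t + of_real u0 * k)) t
        = inverse (of_real \<nu>) * (dx (heat a u e) t + 0)"
      by (intro dx_eqI t has_vector_derivative_mult_right has_vector_derivative_add
          has_vector_derivative_const has_dx heat)
    ultimately have "of_real \<nu> * dx (dx e) t = dx (heat a u e) t"
      using pos by simp
    then show "0 * of_real (rh t) * e t + dx (\<lambda>y. of_real (rh y * uh y) * e y) t
        + of_real (dx eh t) * (of_real (rh t) * u t + of_real (uh t) * \<rho> t)
        + of_real (\<Gamma> * rh t * eh t) * dx u t
        + of_real (\<Gamma> * dx uh t) * (of_real (rh t) * e t + of_real (eh t) * \<rho> t)
        = of_real \<nu> * dx (dx e) t + of_real (2 * \<alpha> * dx uh t) * dx u t"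
      using energy_term_eq_heat[where \<rho> = \<rho>, OF t \<rho>_eq u e mom[OF t]] mass[OF t]
      by (simp add: algebra_simps)
  qed (fact \<rho> u e dxu_diff dxe_diff)+
qed

section \<open>The two solutions defining the Evans function and their end values\<close>

lemma eigen_solution_exists:
  obtains \<rho> u e where "eigen_solution \<Gamma> \<alpha> \<nu> rh uh eh 0 \<rho> u e"
    "\<rho> 0 = 0" "u 0 = 0" "e 0 = 0" "dx u 0 = of_real p" "dx e 0 = of_real q"
proof -
  \<comment> \<open>The integration constants that belong to the prescribed slopes \<open>p\<close>
    and \<open>q\<close>. They are real, so a real first variation coerced to complex values
    suffices.\<close>
  define a k where "a = \<alpha> / u0 * p" and "k = \<nu> / u0 * q + \<alpha> * p"
  define u e where "u t = complex_of_real (fst (var (a, k) t))"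
    and "e t = complex_of_real (snd (var (a, k) t))" for t
  have Z: "((\<lambda>t. (u t, e t)) has_vector_derivative lin t (u t, e t) + forcing t (of_real a, of_real k))
      (at t within {0..1})" if "t \<in> {0..1}" for t
  proof -
    note v = var_has_derivative[OF that, of "(a, k)"]
    have "((\<lambda>t. (u t, e t)) has_vector_derivative
        (of_real (fst (lin t (var (a, k) t) + forcing t (a, k))),
         of_real (snd (lin t (var (a, k) t) + forcing t (a, k))))) (at t within {0..1})"
      unfolding u_def e_def
      by (intro has_vector_derivative_Pair
          bounded_linear.has_vector_derivative[OF bounded_linear_of_real]
          bounded_linear.has_vector_derivative[OF bounded_linear_fst v]
          bounded_linear.has_vector_derivative[OF bounded_linear_snd v])
    then show ?thesis
      by (simp add: lin_def forcing_def u_def e_def scaleR_conv_of_real)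
  qed
  note sol = forced_imp_eigen_solution[OF Z]
  have init: "u 0 = 0" "e 0 = 0" by (simp_all add: u_def e_def var_0)
  have "of_real \<alpha> * dx u 0 = of_real \<alpha> * of_real p"
    using sol(2)[of 0] init pos by (simp add: flux_def a_def)
  moreover have "of_real \<nu> * dx e 0 = of_real \<nu> * of_real q"
    using sol(3)[of 0] init pos by (simp add: heat_def a_def k_def uh_0 algebra_simps)
  ultimately show ?thesis
    using that[OF sol(1)] init pos by simp
qed

lemma eigen_solution_at_1:
  assumes "eigen_solution \<Gamma> \<alpha> \<nu> rh uh eh 0 \<rho> u e" "\<rho> 0 = 0" "u 0 = 0" "e 0 = 0"
  defines "a \<equiv> of_real (\<alpha> / u0) * dx u 0"
    and "k \<equiv> of_real (\<nu> / u0) * dx e 0 + of_real \<alpha> * dx u 0"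
  shows "u 1 = of_real (fst (var (1, 0) 1)) * a + of_real (fst (var (0, 1) 1)) * k"
    "e 1 = of_real (snd (var (1, 0) 1)) * a + of_real (snd (var (0, 1) 1)) * k"
  using forced_solution_eq[of "\<lambda>t. (u t, e t)" "(a, k)" 1]
    eigen_solution_imp_forced[OF assms(1-4)] assms(3,4)
  by (simp_all add: zero_prod_def a_def k_def scaleR_conv_of_real)

text \<open>By \<open>eigen_solution_at_1\<close> the matrix in \<open>Evans\<close> is the Jacobian
  of \<open>Psi\<close> times the matrix with columns \<open>(\<alpha> / u0, \<alpha>)\<close> and
  \<open>(0, \<nu> / u0)\<close>; these are the pairs \<open>(a, k)\<close> for the slopes
  \<open>(1, 0)\<close> and \<open>(0, 1)\<close>.\<close>

lemma Evans_0:
  "Evans \<Gamma> \<alpha> \<nu> rh uh eh 0 = of_real (\<alpha> * \<nu> / u0\<^sup>2 * det (jacobian (Psi \<Gamma> \<alpha> \<nu> u0 e0) (at c)))"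
  unfolding Evans_def
proof (rule the_equality)
  let ?d = "complex_of_real (\<alpha> * \<nu> / u0\<^sup>2 * det (jacobian (Psi \<Gamma> \<alpha> \<nu> u0 e0) (at c)))"
  have det: "det (vector [vector [u1 1, u2 1], vector [e1 1, e2 1]] :: complex^2^2) = ?d"
    if "eigen_solution \<Gamma> \<alpha> \<nu> rh uh eh 0 \<rho>1 u1 e1"
      "\<rho>1 0 = 0" "u1 0 = 0" "e1 0 = 0" "dx u1 0 = 1" "dx e1 0 = 0"
      "eigen_solution \<Gamma> \<alpha> \<nu> rh uh eh 0 \<rho>2 u2 e2"
      "\<rho>2 0 = 0" "u2 0 = 0" "e2 0 = 0" "dx u2 0 = 0" "dx e2 0 = 1"
    for \<rho>1 u1 e1 \<rho>2 u2 e2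
    using eigen_solution_at_1[OF that(1-4)] eigen_solution_at_1[OF that(7-10)] that(5,6,11,12)
    unfolding det_jacobian_Psi(2) by (simp add: det_2 power2_eq_square algebra_simps)
  obtain \<rho>1 u1 e1 where 1: "eigen_solution \<Gamma> \<alpha> \<nu> rh uh eh 0 \<rho>1 u1 e1"
    "\<rho>1 0 = 0" "u1 0 = 0" "e1 0 = 0" "dx u1 0 = 1" "dx e1 0 = 0"
    using eigen_solution_exists[of 1 0] by auto
  obtain \<rho>2 u2 e2 where 2: "eigen_solution \<Gamma> \<alpha> \<nu> rh uh eh 0 \<rho>2 u2 e2"
    "\<rho>2 0 = 0" "u2 0 = 0" "e2 0 = 0" "dx u2 0 = 0" "dx e2 0 = 1"
    using eigen_solution_exists[of 0 1] by auto
  show "\<exists>\<rho>1 u1 e1 \<rho>2 u2 e2.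
        eigen_solution \<Gamma> \<alpha> \<nu> rh uh eh 0 \<rho>1 u1 e1 \<and>
        \<rho>1 0 = 0 \<and> u1 0 = 0 \<and> e1 0 = 0 \<and> dx u1 0 = 1 \<and> dx e1 0 = 0 \<and>
        eigen_solution \<Gamma> \<alpha> \<nu> rh uh eh 0 \<rho>2 u2 e2 \<and>
        \<rho>2 0 = 0 \<and> u2 0 = 0 \<and> e2 0 = 0 \<and> dx u2 0 = 0 \<and> dx e2 0 = 1 \<and>
        ?d = det (vector [vector [u1 1, u2 1], vector [e1 1, e2 1]] :: complex^2^2)"
    using 1 2 det[OF 1 2] by metis
  show "d = ?d" if "\<exists>\<rho>1 u1 e1 \<rho>2 u2 e2.
        eigen_solution \<Gamma> \<alpha> \<nu> rh uh eh 0 \<rho>1 u1 e1 \<and>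
        \<rho>1 0 = 0 \<and> u1 0 = 0 \<and> e1 0 = 0 \<and> dx u1 0 = 1 \<and> dx e1 0 = 0 \<and>
        eigen_solution \<Gamma> \<alpha> \<nu> rh uh eh 0 \<rho>2 u2 e2 \<and>
        \<rho>2 0 = 0 \<and> u2 0 = 0 \<and> e2 0 = 0 \<and> dx u2 0 = 0 \<and> dx e2 0 = 1 \<and>
        d = det (vector [vector [u1 1, u2 1], vector [e1 1, e2 1]] :: complex^2^2)" for d
    using that by (elim exE conjE) (simp only: det)
qed

end

theorem lemma6p1:
  fixes \<Gamma> \<alpha> \<nu> u0 e0 u1 e1 :: real
    and c :: "real^2"
    and uh eh rh :: "real \<Rightarrow> real"
  assumes "\<Gamma> > 0" "\<alpha> > 0" "\<nu> > 0" "u0 > 0" "e0 > 0" "u1 > 0" "e1 > 0"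
    and "c \<in> feasible \<Gamma> \<alpha> \<nu> u0 e0"
    and "Psi \<Gamma> \<alpha> \<nu> u0 e0 c = vector [u1, e1]"
    and "is_profile \<Gamma> \<alpha> \<nu> u0 e0 c uh eh"
    and "\<forall>x\<in>{0..1}. rh x = u0 / uh x"
  shows "Psi \<Gamma> \<alpha> \<nu> u0 e0 differentiable (at c) \<and>
         Evans \<Gamma> \<alpha> \<nu> rh uh eh 0
           = complex_of_real (\<alpha> * \<nu> / u0\<^sup>2 * det (jacobian (Psi \<Gamma> \<alpha> \<nu> u0 e0) (at c))) \<and>
         sgn (Evans \<Gamma> \<alpha> \<nu> rh uh eh 0)
           = complex_of_real (sgn (det (jacobian (Psi \<Gamma> \<alpha> \<nu> u0 e0) (at c))))"
proof -
  interpret steady_state \<Gamma> \<alpha> \<nu> u0 e0 c uh eh rh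
    using assms by unfold_locales auto
  have "0 < \<alpha> * \<nu> / u0\<^sup>2" using assms by simp
  then have "sgn (\<alpha> * \<nu> / u0\<^sup>2 * d) = sgn d" for d
    by (simp only: sgn_mult sgn_pos mult_1)
  then show ?thesis
    unfolding Evans_0 sgn_of_real using det_jacobian_Psi(1) by simp
qed

end
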